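(* Consider the following system of partial differential equations for functions $F_0,F_1,G_0,G_1$ of $(u,v)$, functions $\alpha,\kappa,\mu$ of $u$ alone, and functions $\beta,\eta,\xi$ of $v$ alone, with $F_1\neq0$, $G_1\ne0$, $F_1G_1\neq1$: $$\begin{aligned} F_{1,u}+G_1F_{1,v}&=0, & G_{1,v}+F_1G_{1,u}&=0,\\ G_0F_{1,v}&=(\alpha-\eta)F_1, & F_0G_{1,u}&=(\beta-\kappa)G_1,\\ F_{0,u}+G_1F_{0,v}&=\kappa-F_1G_1\beta, & G_{0,v}+F_1G_{0,u}&=\eta-F_1G_1\alpha,\\ G_0F_{0,v}&=\mu+\alpha F_0-(\xi+\beta G_0)F_1, & F_0G_{0,u}&=\xi+\beta G_0-(\mu+\alpha F_0)G_1. \end{aligned}$$ The space of (local) solutions to this system satisfying $F_0G_0\neq0$ is finite-dimensional, with dimension at most $10$.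
   Context: All functions are smooth, real-valued and defined locally; subscripts $,u$ and $,v$ denote partial derivatives. The unknowns are $F_0,F_1,G_0,G_1,\alpha,\beta,\kappa,\eta,\mu,\xi$. "The space of solutions has dimension at most $d$" means that local solutions near a given point depend on at most $d$ real parameters (in the sense of total differential systems/Frobenius theory: a solution is determined locally by the values at one point of finitely many derivatives of the unknowns, and these values are constrained to a set of dimension at most $d$). The conditions $F_1\ne0$, $G_1\neq0$, $F_1G_1\ne1$ are the nondegeneracy conditions under which $u_x=F_0+F_1v_x$, $v_y=G_0+G_1u_y$ defines a normal Bäcklund transformation between $u_{xy}=\mu+\alpha u_x+\kappa u_y$ and $v_{xy}=\xi+\eta v_x+\beta v_y$. *)

theory Defs
  imports "HOL-Analysis.Analysis"
begin

fun Ck_on :: "nat \<Rightarrow> 'a::euclidean_space set \<Rightarrow> ('a \<Rightarrow> real) \<Rightarrow> bool" where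
  "Ck_on 0 S f \<longleftrightarrow> continuous_on S f"
| "Ck_on (Suc k) S f \<longleftrightarrow>
     (\<forall>x\<in>S. f differentiable (at x)) \<and>
     (\<forall>b\<in>Basis. Ck_on k S (\<lambda>x. frechet_derivative f (at x) b))"

(* C-infinity on S; only used for open S, since the derivatives are taken "at x". *)
definition smooth_on :: "'a::euclidean_space set \<Rightarrow> ('a \<Rightarrow> real) \<Rightarrow> bool" where
  "smooth_on S f \<longleftrightarrow> (\<forall>k. Ck_on k S f)"

definition pdu :: "(real \<Rightarrow> real \<Rightarrow> real) \<Rightarrow> real \<Rightarrow> real \<Rightarrow> real" where
  "pdu f u v = deriv (\<lambda>u. f u v) u"

definition pdv :: "(real \<Rightarrow> real \<Rightarrow> real) \<Rightarrow> real \<Rightarrow> real \<Rightarrow> real" where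
  "pdv f u v = deriv (\<lambda>v. f u v) v"

record unknowns =
  F0 :: "real \<Rightarrow> real \<Rightarrow> real"
  F1 :: "real \<Rightarrow> real \<Rightarrow> real"
  G0 :: "real \<Rightarrow> real \<Rightarrow> real"
  G1 :: "real \<Rightarrow> real \<Rightarrow> real"
  \<alpha> :: "real \<Rightarrow> real"
  \<kappa> :: "real \<Rightarrow> real"
  \<mu> :: "real \<Rightarrow> real"
  \<beta> :: "real \<Rightarrow> real"
  \<eta> :: "real \<Rightarrow> real"
  \<xi> :: "real \<Rightarrow> real"

definition satisfies_system :: "unknowns \<Rightarrow> real \<Rightarrow> real \<Rightarrow> bool" where
  "satisfies_system s u v \<longleftrightarrow>
     pdu (F1 s) u v + G1 s u v * pdv (F1 s) u v = 0 \<and>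
     pdv (G1 s) u v + F1 s u v * pdu (G1 s) u v = 0 \<and>
     G0 s u v * pdv (F1 s) u v = (\<alpha> s u - \<eta> s v) * F1 s u v \<and>
     F0 s u v * pdu (G1 s) u v = (\<beta> s v - \<kappa> s u) * G1 s u v \<and>
     pdu (F0 s) u v + G1 s u v * pdv (F0 s) u v = \<kappa> s u - F1 s u v * G1 s u v * \<beta> s v \<and>
     pdv (G0 s) u v + F1 s u v * pdu (G0 s) u v = \<eta> s v - F1 s u v * G1 s u v * \<alpha> s u \<and>
     G0 s u v * pdv (F0 s) u v =
       \<mu> s u + \<alpha> s u * F0 s u v - (\<xi> s v + \<beta> s v * G0 s u v) * F1 s u v \<and>
     F0 s u v * pdu (G0 s) u v =
       \<xi> s v + \<beta> s v * G0 s u v - (\<mu> s u + \<alpha> s u * F0 s u v) * G1 s u v"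

definition nondegenerate :: "unknowns \<Rightarrow> real \<Rightarrow> real \<Rightarrow> bool" where
  "nondegenerate s u v \<longleftrightarrow> F1 s u v \<noteq> 0 \<and> G1 s u v \<noteq> 0 \<and> F1 s u v * G1 s u v \<noteq> 1"

(* The functions are total in HOL; only their values on some neighbourhood I \<times> J matter. *)
definition local_solution :: "real \<Rightarrow> real \<Rightarrow> unknowns \<Rightarrow> bool" where
  "local_solution u0 v0 s \<longleftrightarrow>
     (\<exists>I J. open I \<and> open J \<and> u0 \<in> I \<and> v0 \<in> J \<and>
        (\<forall>f\<in>{F0 s, F1 s, G0 s, G1 s}. smooth_on (I \<times> J) (\<lambda>(u, v). f u v)) \<and>
        (\<forall>f\<in>{\<alpha> s, \<kappa> s, \<mu> s}. smooth_on I f) \<and>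
        (\<forall>f\<in>{\<beta> s, \<eta> s, \<xi> s}. smooth_on J f) \<and>
        (\<forall>u\<in>I. \<forall>v\<in>J. nondegenerate s u v \<and> satisfies_system s u v))"

definition same_germ :: "real \<Rightarrow> real \<Rightarrow> unknowns \<Rightarrow> unknowns \<Rightarrow> bool" where
  "same_germ u0 v0 s t \<longleftrightarrow>
     (\<exists>I J. open I \<and> open J \<and> u0 \<in> I \<and> v0 \<in> J \<and>
        (\<forall>u\<in>I. \<forall>v\<in>J. F0 s u v = F0 t u v \<and> F1 s u v = F1 t u v \<and>
                      G0 s u v = G0 t u v \<and> G1 s u v = G1 t u v) \<and>
        (\<forall>u\<in>I. \<alpha> s u = \<alpha> t u \<and> \<kappa> s u = \<kappa> t u \<and> \<mu> s u = \<mu> t u) \<and>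
        (\<forall>v\<in>J. \<beta> s v = \<beta> t v \<and> \<eta> s v = \<eta> t v \<and> \<xi> s v = \<xi> t v))"

definition components :: "unknowns \<Rightarrow> (real \<Rightarrow> real \<Rightarrow> real) list" where
  "components s =
     [F0 s, F1 s, G0 s, G1 s,
      \<lambda>u v. \<alpha> s u, \<lambda>u v. \<kappa> s u, \<lambda>u v. \<mu> s u,
      \<lambda>u v. \<beta> s v, \<lambda>u v. \<eta> s v, \<lambda>u v. \<xi> s v]"

(* The N-jet at (u0, v0): entry (c, i, j) is the i-th u-, j-th v-derivative of the c-th unknown.
   It has only finitely many meaningful entries; the others are set to 0. *)
definition jet :: "nat \<Rightarrow> real \<Rightarrow> real \<Rightarrow> unknowns \<Rightarrow> nat \<times> nat \<times> nat \<Rightarrow> real" where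
  "jet N u0 v0 s = (\<lambda>(c, i, j).
     if c < length (components s) \<and> i + j \<le> N
     then (pdu ^^ i) ((pdv ^^ j) (components s ! c)) u0 v0 else 0)"

(* A set of points with coordinates indexed by 'i has dimension at most CARD('d) if countably many
   smooth parametrizations by open subsets of R^CARD('d) cover it. *)
definition dim_at_most :: "'d::finite itself \<Rightarrow> ('i \<Rightarrow> real) set \<Rightarrow> bool" where
  "dim_at_most (_ :: 'd itself) S \<longleftrightarrow>
     (\<exists>(U :: nat \<Rightarrow> (real ^ 'd) set) (\<phi> :: nat \<Rightarrow> real ^ 'd \<Rightarrow> 'i \<Rightarrow> real).
        (\<forall>n. open (U n) \<and> (\<forall>i. smooth_on (U n) (\<lambda>x. \<phi> n x i))) \<and>
        S \<subseteq> (\<Union>n. \<phi> n ` U n))"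

(* Dimension in the sense of total differential systems: a germ of a solution in X is determined
   by its derivatives at (u0, v0) up to some finite order, and these derivatives are constrained
   to a set of dimension at most CARD('d). *)
definition solution_space_dim_at_most ::
    "'d::finite itself \<Rightarrow> real \<Rightarrow> real \<Rightarrow> unknowns set \<Rightarrow> bool" where
  "solution_space_dim_at_most d u0 v0 X \<longleftrightarrow>
     (\<exists>N. (\<forall>s\<in>X. \<forall>t\<in>X. jet N u0 v0 s = jet N u0 v0 t \<longrightarrow> same_germ u0 v0 s t) \<and>
          dim_at_most d (jet N u0 v0 ` X))"

end

theory Submission
  imports Defs
begin

text \<open>
Since \<open>F0\<close> and \<open>G0\<close> do not vanish, the system can be solved for all first derivatives of \<open>F0, F1, G0, G1\<close>.
Equality of the mixed partials of these four functions gives four relations between the derivatives of the six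
functions of one variable. They express \<open>\<alpha>', \<kappa>', \<beta>', \<eta>'\<close> by the values of the ten unknowns and by
\<open>\<mu>'\<close> and \<open>\<xi>'\<close>, and these twelve numbers form the state of a solution at a point. Differentiating the
relations once more determines \<open>\<mu>''\<close> and \<open>\<xi>''\<close>, so the state satisfies a closed system of first order in each
variable (\<open>u_rate\<close>). A Gronwall estimate along horizontal and then vertical lines shows that the state at
one point, hence the 1-jet there, determines the germ (\<open>state_at_unique\<close>).

This leaves twelve parameters, two too many. But \<open>\<mu>''\<close> is determined twice, as is \<open>\<xi>''\<close>, and the
comparison gives one condition for each (\<open>obstr_zero\<close> and its mirror image). Both are affine in \<open>\<mu>'\<close> and \<open>\<xi>'\<close>
(\<open>obstr_affine\<close>), so they form a system of two linear equations for \<open>\<mu>'\<close> and \<open>\<xi>'\<close>. The decisive fact is that the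
four entries of its matrix are independent functions of the other coordinates: they can be used as coordinates
in place of \<open>F1,v\<close>, \<open>G1,u\<close>, \<open>\<eta>\<close>, \<open>\<kappa>\<close>, the only obstacle being a determinant that is nonzero when
\<open>F1 G1\<close> is neither \<open>0\<close> nor \<open>1\<close> (\<open>state_of_surj\<close>). Every rank of the matrix therefore costs enough parameters.
At rank 2 both \<open>\<mu>'\<close> and \<open>\<xi>'\<close> are determined by the ten other coordinates. At rank 1 the
matrix depends on three parameters instead of four and one of \<open>\<mu>'\<close>, \<open>\<xi>'\<close> is determined, which gives
\<open>6 + 3 + 1 = 10\<close>. At rank 0 there are \<open>6 + 2\<close> parameters. In each case the parametrization is by rational functions
without poles, hence smooth (\<open>dim_admissible\<close>).

The system is invariant under the exchange of \<open>u\<close> and \<open>v\<close> together with \<open>F\<close> and \<open>G\<close>, \<open>\<alpha>\<close> and \<open>\<beta>\<close>, \<open>\<kappa>\<close> and \<open>\<eta>\<close>,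
\<open>\<mu>\<close> and \<open>\<xi>\<close>, so each relation is derived for one of the two variables, and its mirror image is obtained by flipping.
\<close>

section \<open>Calculus of smooth functions\<close>

lemma Ck_on_cong:
  assumes "open S" "\<And>x. x \<in> S \<Longrightarrow> f x = g x" "Ck_on k S f"
  shows "Ck_on k S g"
  using assms(2,3)
proof (induction k arbitrary: f g)
  case 0
  then show ?case using continuous_on_eq[of S f g] by simp
next
  case (Suc k)
  have fd: "frechet_derivative f (at x) = frechet_derivative g (at x)" if "x \<in> S" for x
    by (rule frechet_derivative_transform_within_open[OF _ assms(1) that]) (use Suc.prems that in auto)
  have "g differentiable (at x)" if "x \<in> S" for x
  proof -
    have "(f has_derivative frechet_derivative f (at x)) (at x)"
      using Suc.prems that by (simp add: frechet_derivative_works)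
    then have "(g has_derivative frechet_derivative f (at x)) (at x)"
      by (rule has_derivative_transform_within_open[OF _ assms(1) that]) (use Suc.prems in auto)
    then show ?thesis by (auto simp: differentiable_def)
  qed
  moreover have "Ck_on k S (\<lambda>x. frechet_derivative g (at x) b)" if "b \<in> Basis" for b
    by (rule Suc.IH[of "\<lambda>x. frechet_derivative f (at x) b"]) (use Suc.prems(2) that fd in auto)
  ultimately show ?case by auto
qed

lemma Ck_on_SucD: "Ck_on (Suc k) S f \<Longrightarrow> Ck_on k S f"
proof (induction k arbitrary: f)
  case 0
  then have "continuous (at x within S) f" if "x \<in> S" for x
    using that differentiable_imp_continuous_within[of f x UNIV] continuous_at_imp_continuous_within[of x f S]
    by simp
  then show ?case by (simp add: continuous_on_eq_continuous_within)
next
  case (Suc k)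
  from Suc.prems have "\<forall>x\<in>S. f differentiable (at x)"
    and "\<forall>b\<in>Basis. Ck_on (Suc k) S (\<lambda>x. frechet_derivative f (at x) b)"
    unfolding Ck_on.simps(2)[of "Suc k"] by simp_all
  then show ?case using Suc.IH by simp
qed

lemma Ck_on_const: "Ck_on k S (\<lambda>x. c)"
  by (induction k arbitrary: c) auto

lemma Ck_on_add:
  assumes "open S" "Ck_on k S f" "Ck_on k S g"
  shows "Ck_on k S (\<lambda>x. f x + g x)"
  using assms(2,3)
proof (induction k arbitrary: f g)
  case 0
  then show ?case using continuous_on_add[of S f g] by simp
next
  case (Suc k)
  have "Ck_on k S (\<lambda>x. frechet_derivative (\<lambda>x. f x + g x) (at x) b)" if "b \<in> Basis" for b
  proof (rule Ck_on_cong[OF assms(1)])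
    show "Ck_on k S (\<lambda>x. frechet_derivative f (at x) b + frechet_derivative g (at x) b)"
      using Suc that by auto
    show "frechet_derivative f (at x) b + frechet_derivative g (at x) b =
          frechet_derivative (\<lambda>x. f x + g x) (at x) b" if "x \<in> S" for x
    proof -
      have "((\<lambda>x. f x + g x) has_derivative
          (\<lambda>h. frechet_derivative f (at x) h + frechet_derivative g (at x) h)) (at x)"
        using Suc.prems that by (intro has_derivative_add) (auto simp: frechet_derivative_works)
      from frechet_derivative_at[OF this] show ?thesis by metis
    qed
  qed
  then show ?case using Suc.prems by auto
qed

lemma Ck_on_mult:
  assumes "open S" "Ck_on k S f" "Ck_on k S g"
  shows "Ck_on k S (\<lambda>x. f x * g x)"
  using assms(2,3)
proof (induction k arbitrary: f g)
  case 0
  then show ?case using continuous_on_mult[of S f g] by simp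
next
  case (Suc k)
  have "Ck_on k S (\<lambda>x. frechet_derivative (\<lambda>x. f x * g x) (at x) b)" if b: "b \<in> Basis" for b
  proof (rule Ck_on_cong[OF assms(1)])
    show "Ck_on k S (\<lambda>x. f x * frechet_derivative g (at x) b + frechet_derivative f (at x) b * g x)"
      using Suc.prems b Ck_on_SucD[OF Suc.prems(1)] Ck_on_SucD[OF Suc.prems(2)]
      by (intro Ck_on_add[OF assms(1)] Suc.IH) auto
    show "f x * frechet_derivative g (at x) b + frechet_derivative f (at x) b * g x =
          frechet_derivative (\<lambda>x. f x * g x) (at x) b" if x: "x \<in> S" for x
    proof -
      have "((\<lambda>x. f x * g x) has_derivative
          (\<lambda>h. f x * frechet_derivative g (at x) h + frechet_derivative f (at x) h * g x)) (at x)"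
        using Suc.prems x by (intro has_derivative_mult) (auto simp: frechet_derivative_works)
      from frechet_derivative_at[OF this] show ?thesis by metis
    qed
  qed
  then show ?case using Suc.prems by auto
qed

lemma Ck_on_inverse:
  assumes "open S" "Ck_on k S f" "\<And>x. x \<in> S \<Longrightarrow> f x \<noteq> 0"
  shows "Ck_on k S (\<lambda>x. inverse (f x))"
  using assms(2)
proof (induction k)
  case 0
  then show ?case using assms(3) continuous_on_inverse[of S f] by simp
next
  case (Suc k)
  note IH = Suc.IH[OF Ck_on_SucD[OF Suc.prems]]
  have "Ck_on k S (\<lambda>x. frechet_derivative (\<lambda>x. inverse (f x)) (at x) b)" if b: "b \<in> Basis" for b
  proof (rule Ck_on_cong[OF assms(1)])
    show "Ck_on k S (\<lambda>x. (-1) * (inverse (f x) * frechet_derivative f (at x) b * inverse (f x)))"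
      using Suc.prems b IH by (intro Ck_on_mult[OF assms(1)] Ck_on_const) auto
    show "(-1) * (inverse (f x) * frechet_derivative f (at x) b * inverse (f x)) =
          frechet_derivative (\<lambda>x. inverse (f x)) (at x) b" if x: "x \<in> S" for x
    proof -
      have "((\<lambda>x. inverse (f x)) has_derivative
          (\<lambda>h. - (inverse (f x) * frechet_derivative f (at x) h * inverse (f x)))) (at x)"
        using Suc.prems x assms(3)
        by (intro Deriv.has_derivative_inverse) (auto simp: frechet_derivative_works)
      from frechet_derivative_at[OF this] show ?thesis by (metis mult_minus1)
    qed
  qed
  moreover have "(\<lambda>x. inverse (f x)) differentiable (at x)" if "x \<in> S" for x
    using Suc.prems assms(3) that by (auto intro: differentiable_inverse)
  ultimately show ?case by auto
qed

lemma Ck_on_linear: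
  assumes "bounded_linear h"
  shows "Ck_on k S h"
proof (cases k)
  case 0
  then show ?thesis using assms by (simp add: linear_continuous_on)
next
  case (Suc l)
  have "frechet_derivative h (at x) = h" for x
    using frechet_derivative_at[OF bounded_linear_imp_has_derivative[OF assms]] by metis
  then show ?thesis
    by (simp add: Suc assms Ck_on_const bounded_linear_imp_differentiable)
qed

lemma smooth_on_const: "smooth_on S (\<lambda>x. c)"
  and smooth_on_linear: "bounded_linear h \<Longrightarrow> smooth_on S h"
  by (simp_all add: smooth_on_def Ck_on_const Ck_on_linear)

context
  fixes S :: "'a::euclidean_space set"
  assumes S: "open S"
begin

lemma smooth_on_add: "smooth_on S f \<Longrightarrow> smooth_on S g \<Longrightarrow> smooth_on S (\<lambda>x. f x + g x)"
  and smooth_on_mult: "smooth_on S f \<Longrightarrow> smooth_on S g \<Longrightarrow> smooth_on S (\<lambda>x. f x * g x)"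
  and smooth_on_inverse:
    "smooth_on S f \<Longrightarrow> (\<And>x. x \<in> S \<Longrightarrow> f x \<noteq> 0) \<Longrightarrow> smooth_on S (\<lambda>x. inverse (f x))"
  unfolding smooth_on_def
  using Ck_on_add[OF S] Ck_on_mult[OF S] Ck_on_inverse[OF S] by blast+

lemma smooth_on_minus: "smooth_on S f \<Longrightarrow> smooth_on S (\<lambda>x. - f x)"
  using smooth_on_mult[OF smooth_on_const, of f "-1"] by simp

lemma smooth_on_diff: "smooth_on S f \<Longrightarrow> smooth_on S g \<Longrightarrow> smooth_on S (\<lambda>x. f x - g x)"
  using smooth_on_add[OF _ smooth_on_minus, of f g] by simp

lemma smooth_on_divide:
  "smooth_on S f \<Longrightarrow> smooth_on S g \<Longrightarrow> (\<And>x. x \<in> S \<Longrightarrow> g x \<noteq> 0) \<Longrightarrow> smooth_on S (\<lambda>x. f x / g x)"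
  using smooth_on_mult[OF _ smooth_on_inverse, of f g] by (simp add: divide_inverse)

lemma smooth_on_power: "smooth_on S f \<Longrightarrow> smooth_on S (\<lambda>x. f x ^ n)"
  by (induction n) (simp_all add: smooth_on_const smooth_on_mult)

end

lemma smooth_on_differentiable: "smooth_on S f \<Longrightarrow> x \<in> S \<Longrightarrow> f differentiable (at x)"
  unfolding smooth_on_def by (metis Ck_on.simps(2))

lemma smooth_on_continuous: "smooth_on S f \<Longrightarrow> continuous_on S f"
  unfolding smooth_on_def by (metis Ck_on.simps(1))

lemma smooth_on_frechet:
  "smooth_on S f \<Longrightarrow> b \<in> Basis \<Longrightarrow> smooth_on S (\<lambda>x. frechet_derivative f (at x) b)"
  unfolding smooth_on_def by (metis Ck_on.simps(2))

lemma smooth_on_cong: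
  "open S \<Longrightarrow> (\<And>x. x \<in> S \<Longrightarrow> f x = g x) \<Longrightarrow> smooth_on S f \<Longrightarrow> smooth_on S g"
  unfolding smooth_on_def by (metis Ck_on_cong)

text \<open>Exchanging \<open>u\<close> and \<open>v\<close> maps the system to itself, and this lemma is what lets every statement about
\<open>u\<close>-derivatives be reused for \<open>v\<close>-derivatives.\<close>
lemma Ck_on_swap:
  fixes f :: "real \<times> real \<Rightarrow> real"
  assumes "open I" "open J" "Ck_on k (I \<times> J) f"
  shows "Ck_on k (J \<times> I) (\<lambda>x. f (prod.swap x))"
  using assms(3)
proof (induction k arbitrary: f)
  case 0
  have "continuous_on (J \<times> I) (f \<circ> prod.swap)"
    using 0 by (intro continuous_on_compose continuous_on_swap) (simp add: product_swap)
  then show ?case by (simp add: comp_def)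
next
  case (Suc k)
  have d: "((\<lambda>x. f (prod.swap x)) has_derivative
      (\<lambda>h. frechet_derivative f (at (prod.swap x)) (prod.swap h))) (at x)" if x: "x \<in> J \<times> I" for x
  proof -
    have "(prod.swap has_derivative prod.swap) (at x)"
      unfolding prod.swap_def by (auto intro!: derivative_eq_intros)
    moreover have "(f has_derivative frechet_derivative f (at (prod.swap x))) (at (prod.swap x))"
      using Suc.prems x by (auto simp: frechet_derivative_works[symmetric])
    ultimately show ?thesis
      using has_derivative_compose by blast
  qed
  have "Ck_on k (J \<times> I) (\<lambda>x. frechet_derivative (\<lambda>x. f (prod.swap x)) (at x) b)"
    if b: "b \<in> Basis" for b
  proof (rule Ck_on_cong)
    show "open (J \<times> I)" using assms by (simp add: open_Times)
    have "prod.swap b \<in> Basis" using b by (auto simp: Basis_prod_def)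
    then show "Ck_on k (J \<times> I) (\<lambda>x. frechet_derivative f (at (prod.swap x)) (prod.swap b))"
      using Suc.prems Suc.IH[of "\<lambda>x. frechet_derivative f (at x) (prod.swap b)"] by auto
    show "frechet_derivative f (at (prod.swap x)) (prod.swap b) =
        frechet_derivative (\<lambda>x. f (prod.swap x)) (at x) b" if "x \<in> J \<times> I" for x
      using frechet_derivative_at[OF d[OF that]] by metis
  qed
  moreover have "(\<lambda>x. f (prod.swap x)) differentiable (at x)" if "x \<in> J \<times> I" for x
    using d[OF that] unfolding differentiable_def by blast
  ultimately show ?case by simp
qed

lemma smooth_on_swap:
  fixes f :: "real \<Rightarrow> real \<Rightarrow> real"
  assumes "open I" "open J" "smooth_on (I \<times> J) (\<lambda>(u, v). f u v)"
  shows "smooth_on (J \<times> I) (\<lambda>(v, u). f u v)"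
proof -
  have "(\<lambda>x. (\<lambda>(u, v). f u v) (prod.swap x)) = (\<lambda>(v, u). f u v)" by auto
  with assms Ck_on_swap[of I J _ "\<lambda>(u, v). f u v"] show ?thesis unfolding smooth_on_def by auto
qed

lemma smooth_on_pdu:
  fixes f :: "real \<Rightarrow> real \<Rightarrow> real"
  assumes "open I" "open J" and sm: "smooth_on (I \<times> J) (\<lambda>(u, v). f u v)"
  shows "u \<in> I \<Longrightarrow> v \<in> J \<Longrightarrow> ((\<lambda>u. f u v) has_real_derivative pdu f u v) (at u)"
    and "smooth_on (I \<times> J) (\<lambda>(u, v). pdu f u v)"
proof -
  have D: "((\<lambda>u. f u v) has_real_derivative frechet_derivative (\<lambda>(u, v). f u v) (at (u, v)) (1, 0)) (at u)"
    if "u \<in> I" "v \<in> J" for u v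
  proof -
    let ?D = "frechet_derivative (\<lambda>(u, v). f u v) (at (u, v))"
    have "((\<lambda>(u, v). f u v) has_derivative ?D) (at (u, v))"
      using smooth_on_differentiable[OF sm] that by (simp add: frechet_derivative_works)
    then have 1: "((\<lambda>x. (\<lambda>(u, v). f u v) (x, v)) has_derivative (\<lambda>h. ?D (h, 0))) (at u)"
      by (intro has_derivative_compose[where f = "\<lambda>x. (x, v)" and g = "\<lambda>(u, v). f u v"])
        (auto intro!: derivative_eq_intros)
    have "linear ?D" using smooth_on_differentiable[OF sm] that by (intro linear_frechet_derivative) auto
    then have "?D (h, 0) = h * ?D (1, 0)" for h using linear_scale[of ?D h "(1, 0)"] by simp
    then have "(\<lambda>h. ?D (h, 0)) = (\<lambda>h. h * ?D (1, 0))" by (rule ext)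
    also have "\<dots> = (*) (?D (1, 0))" by (rule ext) (rule mult.commute)
    finally have 2: "(\<lambda>h. ?D (h, 0)) = (*) (?D (1, 0))" .
    from 1 show ?thesis unfolding has_field_derivative_def case_prod_conv 2 .
  qed
  then have eq: "pdu f u v = frechet_derivative (\<lambda>(u, v). f u v) (at (u, v)) (1, 0)"
    if "u \<in> I" "v \<in> J" for u v
    using that unfolding pdu_def by (metis DERIV_imp_deriv)
  show "u \<in> I \<Longrightarrow> v \<in> J \<Longrightarrow> ((\<lambda>u. f u v) has_real_derivative pdu f u v) (at u)"
    using D eq by simp
  have "smooth_on (I \<times> J) (\<lambda>x. frechet_derivative (\<lambda>(u, v). f u v) (at x) (1, 0))"
    by (rule smooth_on_frechet[OF sm]) (simp add: Basis_prod_def)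
  then show "smooth_on (I \<times> J) (\<lambda>(u, v). pdu f u v)"
    by (rule smooth_on_cong[rotated 2]) (auto simp: eq open_Times assms)
qed

lemma pdv_conv_pdu: "pdv f u v = pdu (\<lambda>v u. f u v) v u"
  by (simp add: pdu_def pdv_def)

lemma smooth_on_pdv:
  fixes f :: "real \<Rightarrow> real \<Rightarrow> real"
  assumes "open I" "open J" and sm: "smooth_on (I \<times> J) (\<lambda>(u, v). f u v)"
  shows "u \<in> I \<Longrightarrow> v \<in> J \<Longrightarrow> ((\<lambda>v. f u v) has_real_derivative pdv f u v) (at v)"
    and "smooth_on (I \<times> J) (\<lambda>(u, v). pdv f u v)"
proof -
  note sm' = smooth_on_swap[OF assms]
  show "u \<in> I \<Longrightarrow> v \<in> J \<Longrightarrow> ((\<lambda>v. f u v) has_real_derivative pdv f u v) (at v)"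
    unfolding pdv_conv_pdu by (rule smooth_on_pdu(1)[OF assms(2,1) sm'])
  show "smooth_on (I \<times> J) (\<lambda>(u, v). pdv f u v)"
    unfolding pdv_conv_pdu
    by (rule smooth_on_swap[OF assms(2,1) smooth_on_pdu(2)[OF assms(2,1) sm']])
qed

lemma smooth_on_deriv:
  fixes h :: "real \<Rightarrow> real"
  assumes "open I" and sm: "smooth_on I h"
  shows "u \<in> I \<Longrightarrow> (h has_real_derivative deriv h u) (at u)"
    and "smooth_on I (deriv h)"
proof -
  have D: "(h has_real_derivative frechet_derivative h (at u) 1) (at u)" if "u \<in> I" for u
  proof -
    let ?D = "frechet_derivative h (at u)"
    have d: "h differentiable (at u)" using smooth_on_differentiable[OF sm that] .
    have "?D x = x * ?D 1" for x
      using linear_scale[OF linear_frechet_derivative[OF d], of x 1] by simp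
    then have "?D = (\<lambda>x. x * ?D 1)" by (rule ext)
    also have "\<dots> = (*) (?D 1)" by (rule ext) (rule mult.commute)
    finally have "?D = (*) (?D 1)" .
    with d show ?thesis unfolding frechet_derivative_works has_field_derivative_def by argo
  qed
  then have eq: "deriv h u = frechet_derivative h (at u) 1" if "u \<in> I" for u
    using that by (metis DERIV_imp_deriv)
  show "u \<in> I \<Longrightarrow> (h has_real_derivative deriv h u) (at u)" using D eq by simp
  have "smooth_on I (\<lambda>u. frechet_derivative h (at u) 1)"
    by (rule smooth_on_frechet[OF sm]) simp
  then show "smooth_on I (deriv h)"
    by (rule smooth_on_cong[rotated 2]) (auto simp: eq assms)
qed

text \<open>The second difference of \<open>f\<close> over a square does not depend on the order of the two differences, but
applying the mean value theorem twice turns it into either mixed partial, according to that order.\<close>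
lemma second_difference_mvt:
  fixes f :: "real \<Rightarrow> real \<Rightarrow> real"
  assumes "\<And>x y. a \<le> x \<Longrightarrow> x \<le> a + h \<Longrightarrow> b \<le> y \<Longrightarrow> y \<le> b + h \<Longrightarrow>
      ((\<lambda>x. f x y) has_real_derivative p x y) (at x) \<and> ((\<lambda>y. p x y) has_real_derivative q x y) (at y)"
    and "h > 0"
  obtains x y where "a < x" "x < a + h" "b < y" "y < b + h"
    "f (a + h) (b + h) - f (a + h) b - f a (b + h) + f a b = h * h * q x y"
proof -
  obtain x where x: "a < x" "x < a + h"
    and 1: "(f (a + h) (b + h) - f (a + h) b) - (f a (b + h) - f a b) = h * (p x (b + h) - p x b)"
  proof -
    have "((\<lambda>x. f x (b + h) - f x b) has_real_derivative p x (b + h) - p x b) (at x)"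
      if "a \<le> x" "x \<le> a + h" for x
      using assms(1)[OF that, of "b + h"] assms(1)[OF that, of b] \<open>h > 0\<close> by (intro DERIV_diff) auto
    from MVT2[of a "a + h", OF _ this] \<open>h > 0\<close> that show thesis by auto
  qed
  obtain y where "b < y" "y < b + h" "p x (b + h) - p x b = h * q x y"
    using MVT2[of b "b + h" "\<lambda>y. p x y" "\<lambda>y. q x y"] assms x by auto
  with x 1 show ?thesis by (intro that[of x y]) (auto simp: algebra_simps)
qed

lemma mixed_partials_eq:
  fixes f :: "real \<Rightarrow> real \<Rightarrow> real"
  assumes IJ: "open I" "open J" "a \<in> I" "b \<in> J" and sm: "smooth_on (I \<times> J) (\<lambda>(u, v). f u v)"
  shows "pdu (pdv f) a b = pdv (pdu f) a b"
proof (rule ccontr)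
  assume ne: "pdu (pdv f) a b \<noteq> pdv (pdu f) a b"
  note u = smooth_on_pdu[OF IJ(1,2)] and v = smooth_on_pdv[OF IJ(1,2)]
  define e where "e = \<bar>pdu (pdv f) a b - pdv (pdu f) a b\<bar> / 2"
  have e: "e > 0" using ne by (simp add: e_def)
  have cont: "\<exists>d>0. \<forall>x y. \<bar>x - a\<bar> < d \<longrightarrow> \<bar>y - b\<bar> < d \<longrightarrow>
      x \<in> I \<and> y \<in> J \<and> \<bar>g x y - g a b\<bar> < e"
    if "smooth_on (I \<times> J) (\<lambda>(u, v). g u v)" for g
  proof -
    have "isCont (\<lambda>(u, v). g u v) (a, b)"
      using smooth_on_continuous[OF that] IJ by (simp add: continuous_on_eq_continuous_at open_Times)
    then have "((\<lambda>(u, v). g u v) \<longlongrightarrow> g a b) (nhds (a, b))"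
      using tendsto_at_iff_tendsto_nhds[of "\<lambda>(u, v). g u v" "(a, b)"] by (simp add: isCont_def)
    then have "\<forall>\<^sub>F x in nhds (a, b). dist ((\<lambda>(u, v). g u v) x) (g a b) < e"
      using e tendstoD by blast
    moreover have "\<forall>\<^sub>F x in nhds (a, b). x \<in> I \<times> J"
      using IJ by (intro eventually_nhds_in_open) (auto simp: open_Times)
    ultimately have "\<forall>\<^sub>F x in nhds (a, b). x \<in> I \<times> J \<and> dist ((\<lambda>(u, v). g u v) x) (g a b) < e"
      by eventually_elim auto
    then obtain d where d: "d > 0"
      "\<And>x. dist x (a, b) < d \<Longrightarrow> x \<in> I \<times> J \<and> dist ((\<lambda>(u, v). g u v) x) (g a b) < e"
      unfolding eventually_nhds_metric by blast
    have "dist (x, y) (a, b) < d" if "\<bar>x - a\<bar> < d / 2" "\<bar>y - b\<bar> < d / 2" for x y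
      using that sqrt_sum_squares_le_sum_abs[of "x - a" "y - b"]
      by (simp add: dist_Pair_Pair dist_real_def)
    with d show ?thesis by (intro exI[of _ "d / 2"]) (fastforce simp: dist_real_def)
  qed
  obtain d1 d2 where d1: "d1 > 0" "\<And>x y. \<bar>x - a\<bar> < d1 \<Longrightarrow> \<bar>y - b\<bar> < d1 \<Longrightarrow>
      x \<in> I \<and> y \<in> J \<and> \<bar>pdv (pdu f) x y - pdv (pdu f) a b\<bar> < e"
    and d2: "d2 > 0" "\<And>x y. \<bar>x - a\<bar> < d2 \<Longrightarrow> \<bar>y - b\<bar> < d2 \<Longrightarrow>
      x \<in> I \<and> y \<in> J \<and> \<bar>pdu (pdv f) x y - pdu (pdv f) a b\<bar> < e"
    using cont[OF v(2)[OF u(2)[OF sm]]] cont[OF u(2)[OF v(2)[OF sm]]] by metis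
  define h where "h = min d1 d2 / 2"
  have h: "h > 0" "h < d1" "h < d2" using d1(1) d2(1) by (auto simp: h_def)
  obtain x y where xy: "a < x" "x < a + h" "b < y" "y < b + h"
    "f (a + h) (b + h) - f (a + h) b - f a (b + h) + f a b = h * h * pdv (pdu f) x y"
  proof (rule second_difference_mvt[of a h b f "pdu f" "pdv (pdu f)"])
    fix x y assume "a \<le> x" "x \<le> a + h" "b \<le> y" "y \<le> b + h"
    then have "x \<in> I" "y \<in> J" using d1(2)[of x y] h by auto
    then show "((\<lambda>x. f x y) has_real_derivative pdu f x y) (at x) \<and>
        (pdu f x has_real_derivative pdv (pdu f) x y) (at y)"
      using u(1)[OF sm] v(1)[OF u(2)[OF sm]] by auto
  qed (use h in auto)
  obtain x' y' where xy': "b < y'" "y' < b + h" "a < x'" "x' < a + h"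
    "f (a + h) (b + h) - f a (b + h) - f (a + h) b + f a b = h * h * pdu (pdv f) x' y'"
  proof (rule second_difference_mvt[of b h a "\<lambda>y x. f x y" "\<lambda>y x. pdv f x y"
        "\<lambda>y x. pdu (pdv f) x y"])
    fix x y assume "b \<le> x" "x \<le> b + h" "a \<le> y" "y \<le> a + h"
    then have "y \<in> I" "x \<in> J" using d1(2)[of y x] h by auto
    then show "((\<lambda>x. f y x) has_real_derivative pdv f y x) (at x) \<and>
        ((\<lambda>y. pdv f y x) has_real_derivative pdu (pdv f) y x) (at y)"
      using v(1)[OF sm] u(1)[OF v(2)[OF sm]] by auto
  qed (use h in auto)
  have "h * h * pdv (pdu f) x y = h * h * pdu (pdv f) x' y'" using xy(5) xy'(5) by linarith
  then have "pdv (pdu f) x y = pdu (pdv f) x' y'" using h by simp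
  moreover have "\<bar>pdv (pdu f) x y - pdv (pdu f) a b\<bar> < e" using d1(2)[of x y] xy h by auto
  moreover have "\<bar>pdu (pdv f) x' y' - pdu (pdv f) a b\<bar> < e" using d2(2)[of x' y'] xy' h by auto
  ultimately have "\<bar>pdu (pdv f) a b - pdv (pdu f) a b\<bar> < 2 * e" by linarith
  then show False by (simp add: e_def)
qed

section \<open>States and the conditions on them\<close>

text \<open>The first derivatives of all the unknowns can be computed from the values of the ten unknowns at the
point together with \<open>\<mu>'\<close> and \<open>\<xi>'\<close>, the fields \<open>dmu\<close> and \<open>dxi\<close>. Among the six derivatives of functions of one
variable, this choice of two keeps every denominator a product of \<open>F0\<close>, \<open>G0\<close>, \<open>F1\<close>, \<open>G1\<close>; a choice
such as \<open>\<alpha>', \<beta>'\<close> would divide by \<open>1 - (F1 G1)\<^sup>2\<close>, which may vanish.\<close>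
record state =
  f0 :: real
  f1 :: real
  g0 :: real
  g1 :: real
  al :: real
  ka :: real
  mu :: real
  be :: real
  et :: real
  xi :: real
  dmu :: real
  dxi :: real

text \<open>The exchange of \<open>u\<close> and \<open>v\<close>, under which \<open>F\<close> and \<open>G\<close>, \<open>\<alpha>\<close> and \<open>\<beta>\<close>, \<open>\<kappa>\<close> and \<open>\<eta>\<close>, \<open>\<mu>\<close> and \<open>\<xi>\<close> trade places.\<close>
definition flip :: "state \<Rightarrow> state" where
  "flip s = \<lparr>f0 = g0 s, f1 = g1 s, g0 = f0 s, g1 = f1 s, al = be s, ka = et s, mu = xi s,
     be = al s, et = ka s, xi = mu s, dmu = dxi s, dxi = dmu s\<rparr>"

lemma flip_simps [simp]:
  "f0 (flip s) = g0 s" "f1 (flip s) = g1 s" "g0 (flip s) = f0 s" "g1 (flip s) = f1 s"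
  "al (flip s) = be s" "ka (flip s) = et s" "mu (flip s) = xi s"
  "be (flip s) = al s" "et (flip s) = ka s" "xi (flip s) = mu s"
  "dmu (flip s) = dxi s" "dxi (flip s) = dmu s" "flip (flip s) = s"
  by (simp_all add: flip_def)

text \<open>On a solution, \<open>A\<close> and \<open>B\<close> are the logarithmic derivatives \<open>F1,v / F1\<close> and \<open>G1,u / G1\<close>, and \<open>Fu\<close>, \<open>Fv\<close>,
\<open>Gu\<close>, \<open>Gv\<close> are the partial derivatives of \<open>F0\<close> and \<open>G0\<close>. Equality of the mixed partials of \<open>F1\<close>, \<open>F0\<close> and
\<open>G0\<close> amounts to

  \<^item> \<open>\<alpha>' - G1 \<eta>' = S1\<close>,
  \<^item> \<open>\<mu>' + F0 \<alpha>' - P \<xi>' = S3\<close>,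
  \<^item> \<open>\<xi>' + G0 \<beta>' - P \<mu>' = S4\<close>,

and \<open>d_al\<close>, \<open>d_be\<close>, \<open>d_et\<close>, \<open>d_ka\<close> are the resulting values of \<open>\<alpha>'\<close>, \<open>\<beta>'\<close>, \<open>\<eta>'\<close>, \<open>\<kappa>'\<close>.\<close>
definition P where "P s = f1 s * g1 s"
definition A where "A s = (al s - et s) / g0 s"
definition B where "B s = A (flip s)"
definition Fv where "Fv s = (mu s + al s * f0 s - (xi s + be s * g0 s) * f1 s) / g0 s"
definition Gu where "Gu s = Fv (flip s)"
definition Fu where "Fu s = ka s - P s * be s - g1 s * Fv s"
definition Gv where "Gv s = Fu (flip s)"
definition S1 where "S1 s = A s * (Gu s + g1 s * Gv s + P s * B s * g0 s)"
definition S3 where "S3 s = - al s * Fu s + P s * be s * Gv s + be s * f1 s * Gu s + Gu s * Fv s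
  - g1 s * al s * Fv s + g1 s * Fv s * Gv s + g0 s * P s * (B s * Fv s - (A s - f1 s * B s) * be s)"
definition S4 where "S4 s = S3 (flip s)"
definition d_al where "d_al s = (S3 s + P s * dxi s - dmu s) / f0 s"
definition d_be where "d_be s = d_al (flip s)"
definition d_et where "d_et s = (d_al s - S1 s) / g1 s"
definition d_ka where "d_ka s = d_et (flip s)"

text \<open>A name ending in \<open>_u\<close> denotes the total derivative in \<open>u\<close> along a solution, computed with
\<open>F1,u = - P A\<close>, \<open>G1,u = G1 B\<close> and with \<open>\<beta>\<close>, \<open>\<eta>\<close>, \<open>\<xi>\<close> constant in \<open>u\<close>. \<open>M\<close> stands for \<open>\<mu> + \<alpha> F0\<close>.\<close>
definition P_u where "P_u s = P s * (B s - g1 s * A s)"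
definition A_u where "A_u s = (d_al s - A s * Gu s) / g0 s"
definition B_u where "B_u s = - (d_ka s + B s * Fu s) / f0 s"
definition M_u where "M_u s = dmu s + d_al s * f0 s + al s * Fu s"
definition Fv_u where "Fv_u s = (M_u s - be s * Gu s * f1 s + (xi s + be s * g0 s) * P s * A s
  - Fv s * Gu s) / g0 s"
definition Gu_u where "Gu_u s = (be s * Gu s - M_u s * g1 s - (mu s + al s * f0 s) * g1 s * B s
  - Gu s * Fu s) / f0 s"
definition Fu_u where "Fu_u s = d_ka s - P_u s * be s - g1 s * B s * Fv s - g1 s * Fv_u s"
definition Gv_u where "Gv_u s = - P_u s * al s - P s * d_al s + P s * A s * Gu s - f1 s * Gu_u s"
definition S1_u where "S1_u s = A_u s * (Gu s + g1 s * Gv s + P s * B s * g0 s)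
  + A s * (Gu_u s + g1 s * B s * Gv s + g1 s * Gv_u s
      + P_u s * B s * g0 s + P s * B_u s * g0 s + P s * B s * Gu s)"
definition S3_u where "S3_u s = - d_al s * Fu s - al s * Fu_u s + P_u s * be s * Gv s + P s * be s * Gv_u s
  - be s * P s * A s * Gu s + be s * f1 s * Gu_u s + Gu_u s * Fv s + Gu s * Fv_u s
  - g1 s * B s * al s * Fv s - g1 s * d_al s * Fv s - g1 s * al s * Fv_u s
  + g1 s * B s * Fv s * Gv s + g1 s * Fv_u s * Gv s + g1 s * Fv s * Gv_u s
  + Gu s * P s * (B s * Fv s - (A s - f1 s * B s) * be s)
  + g0 s * P_u s * (B s * Fv s - (A s - f1 s * B s) * be s)
  + g0 s * P s * (B_u s * Fv s + B s * Fv_u s - (A_u s + P s * A s * B s - f1 s * B_u s) * be s)"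
definition S4_u where "S4_u s = - be s * Gv_u s + P_u s * al s * Fu s + P s * d_al s * Fu s + P s * al s * Fu_u s
  + d_al s * g1 s * Fv s + al s * g1 s * B s * Fv s + al s * g1 s * Fv_u s
  + Fv_u s * Gu s + Fv s * Gu_u s + P s * A s * be s * Gu s - f1 s * be s * Gu_u s
  - P s * A s * Gu s * Fu s + f1 s * Gu_u s * Fu s + f1 s * Gu s * Fu_u s
  + Fu s * P s * (A s * Gu s - (B s - g1 s * A s) * al s)
  + f0 s * P_u s * (A s * Gu s - (B s - g1 s * A s) * al s)
  + f0 s * P s * (A_u s * Gu s + A s * Gu_u s - (B_u s - g1 s * B s * A s - g1 s * A_u s) * al s
      - (B s - g1 s * A s) * d_al s)"
text \<open>The values of \<open>\<alpha>''\<close> and \<open>\<mu>''\<close>, read off from the \<open>u\<close>-derivatives of the relations with right-hand sides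
\<open>S1\<close> and \<open>S3\<close>; they close the system in the direction of \<open>u\<close>.\<close>
definition d2_al where "d2_al s = g1 s * B s * d_et s + S1_u s"
definition d2_mu where "d2_mu s = S3_u s - f0 s * d2_al s - Fu s * d_al s + P_u s * dxi s"
text \<open>What is left of the \<open>u\<close>-derivative of \<open>\<xi>' + G0 \<beta>' - P \<mu>' = S4\<close> once the value of \<open>\<mu>''\<close> is
inserted: a condition on the state alone. Flipped, it gives a second condition.\<close>
definition obstr where "obstr s = S4_u s - Gu s * d_be s + P_u s * dmu s + P s * d2_mu s"

text \<open>The coefficients, up to sign, of \<open>\<mu>'\<close> and \<open>\<xi>'\<close> in \<open>obstr\<close>.\<close>
definition coeff_mu where "coeff_mu s = P s * (P s + 2) * (g1 s * A s - B s)
  + (P s * g1 s * (P s - 1) * et s + P s ^ 2 * Gu s) / g0 s + g1 s * Fv s / f0 s"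
definition coeff_xi where "coeff_xi s = g1 s * A s - P s ^ 2 * B s
  + (g1 s * (1 - P s) * et s - P s * Gu s) / g0 s - P s * g1 s * Fv s / f0 s"

definition base where "base s = s\<lparr>dmu := 0, dxi := 0\<rparr>"

lemma base_fields [simp]:
  "f0 (base s) = f0 s" "f1 (base s) = f1 s" "g0 (base s) = g0 s" "g1 (base s) = g1 s"
  "al (base s) = al s" "ka (base s) = ka s" "mu (base s) = mu s"
  "be (base s) = be s" "et (base s) = et s" "xi (base s) = xi s"
  "dmu (base s) = 0" "dxi (base s) = 0"
  by (simp_all add: base_def)

lemma flip_base: "flip (base s) = base (flip s)"
  by (simp add: flip_def base_def)

lemma base_simps [simp]:
  "P (base s) = P s" "A (base s) = A s" "B (base s) = B s"
  "Fv (base s) = Fv s" "Gu (base s) = Gu s" "Fu (base s) = Fu s" "Gv (base s) = Gv s"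
  "S1 (base s) = S1 s" "S3 (base s) = S3 s" "P_u (base s) = P_u s"
  by (simp_all add: P_def A_def B_def Fv_def Gu_def Fu_def Gv_def S1_def S3_def P_u_def)

lemma flip_derived [simp]:
  "P (flip s) = P s" "A (flip s) = B s" "B (flip s) = A s" "Fv (flip s) = Gu s" "Gu (flip s) = Fv s"
  "Fu (flip s) = Gv s" "Gv (flip s) = Fu s"
  by (simp_all add: B_def Gu_def Gv_def P_def)

text \<open>Each derivative entering \<open>obstr\<close> is affine in \<open>\<mu>'\<close> and \<open>\<xi>'\<close>, and \<open>obstr\<close> multiplies them only by
quantities that are free of \<open>\<mu>'\<close> and \<open>\<xi>'\<close>. The proof tracks the increment of every ingredient between \<open>base s\<close> and \<open>s\<close>;
here \<open>x\<close>, \<open>y\<close> and \<open>w\<close> are the increments of \<open>\<alpha>'\<close>, \<open>\<beta>'\<close> and \<open>M,u\<close>.\<close>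
lemma obstr_affine:
  assumes nz: "f0 s \<noteq> 0" "g0 s \<noteq> 0" "f1 s \<noteq> 0" "g1 s \<noteq> 0"
  shows "obstr s = obstr (base s) - coeff_mu s * dmu s - coeff_xi s * dxi s"
proof -
  define t x y where "t = base s" and "x = (P s * dxi s - dmu s) / f0 s"
    and "y = (P s * dmu s - dxi s) / g0 s"
  define w where "w = P s * dxi s"
  have x: "f0 s * x = w - dmu s" and y: "g0 s * y = P s * dmu s - dxi s"
    using nz by (simp_all add: x_def y_def w_def)
  have al: "d_al s = d_al t + x"
    by (simp add: d_al_def t_def x_def add_divide_distrib diff_divide_distrib)
  have be: "d_be s = d_be t + y"
    by (simp add: d_be_def d_al_def t_def y_def flip_base add_divide_distrib diff_divide_distrib)
  have et: "d_et s = d_et t + x / g1 s"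
    by (simp add: d_et_def al t_def add_divide_distrib diff_divide_distrib)
  have ka: "d_ka s = d_ka t + y / f1 s"
    using be by (simp add: d_ka_def d_et_def d_be_def t_def flip_base add_divide_distrib diff_divide_distrib)
  have A: "A_u s = A_u t + x / g0 s"
    by (simp add: A_u_def al t_def add_divide_distrib diff_divide_distrib)
  have B: "B_u s = B_u t - y / (f0 s * f1 s)"
    by (simp add: B_u_def ka t_def add_divide_distrib diff_divide_distrib mult.commute)
  have M: "M_u s = M_u t + w"
    using x by (simp add: M_u_def al t_def algebra_simps)
  have Fv: "Fv_u s = Fv_u t + w / g0 s"
    by (simp add: Fv_u_def M t_def add_divide_distrib diff_divide_distrib)
  have Gu: "Gu_u s = Gu_u t - w * g1 s / f0 s"
    by (simp add: Gu_u_def M t_def add_divide_distrib diff_divide_distrib distrib_right)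
  have Fu: "Fu_u s = Fu_u t + y / f1 s - g1 s * w / g0 s"
    by (simp add: Fu_u_def ka Fv t_def algebra_simps)
  have Gv: "Gv_u s = Gv_u t - P s * x + P s * w / f0 s"
    using nz by (simp add: Gv_u_def al Gu t_def P_def field_simps)
  obtain dA dB dFv dGu dFu dGv where d: "dA = x / g0 s" "dB = - y / (f0 s * f1 s)" "dFv = w / g0 s"
    "dGu = - w * g1 s / f0 s" "dFu = y / f1 s - g1 s * w / g0 s" "dGv = - P s * x + P s * w / f0 s"
    by blast
  have B: "B_u s = B_u t + dB" and Gu: "Gu_u s = Gu_u t + dGu" and Fu: "Fu_u s = Fu_u t + dFu"
    and Gv: "Gv_u s = Gv_u t + dGv"
    using B Gu Fu Gv by (simp_all add: d)
  note lin = al A[folded d(1)] B Fv[folded d(3)] Gu Fu Gv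
  have S1: "S1_u s = S1_u t + (dA * (Gu s + g1 s * Gv s + P s * B s * g0 s)
      + A s * (dGu + g1 s * dGv + P s * dB * g0 s))"
    unfolding S1_u_def lin by (simp add: t_def algebra_simps)
  have S3: "S3_u s = S3_u t + (- x * Fu s - al s * dFu + P s * be s * dGv + be s * f1 s * dGu + dGu * Fv s
      + Gu s * dFv - g1 s * x * Fv s - g1 s * al s * dFv + g1 s * dFv * Gv s + g1 s * Fv s * dGv
      + g0 s * P s * (dB * Fv s + B s * dFv - (dA - f1 s * dB) * be s))"
    unfolding S3_u_def lin by (simp add: t_def algebra_simps)
  have S4: "S4_u s = S4_u t + (- be s * dGv + P s * x * Fu s + P s * al s * dFu + x * g1 s * Fv s
      + al s * g1 s * dFv + dFv * Gu s + Fv s * dGu - f1 s * be s * dGu + f1 s * dGu * Fu s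
      + f1 s * Gu s * dFu
      + f0 s * P s * (dA * Gu s + A s * dGu - (dB - g1 s * dA) * al s - (B s - g1 s * A s) * x))"
    unfolding S4_u_def lin by (simp add: t_def algebra_simps)
  obtain D1 D3 D4 where D: "S1_u s = S1_u t + D1" "S3_u s = S3_u t + D3" "S4_u s = S4_u t + D4"
    and D': "D1 = dA * (Gu s + g1 s * Gv s + P s * B s * g0 s)
      + A s * (dGu + g1 s * dGv + P s * dB * g0 s)"
     "D3 = - x * Fu s - al s * dFu + P s * be s * dGv + be s * f1 s * dGu + dGu * Fv s
      + Gu s * dFv - g1 s * x * Fv s - g1 s * al s * dFv + g1 s * dFv * Gv s + g1 s * Fv s * dGv
      + g0 s * P s * (dB * Fv s + B s * dFv - (dA - f1 s * dB) * be s)"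
     "D4 = - be s * dGv + P s * x * Fu s + P s * al s * dFu + x * g1 s * Fv s
      + al s * g1 s * dFv + dFv * Gu s + Fv s * dGu - f1 s * be s * dGu + f1 s * dGu * Fu s
      + f1 s * Gu s * dFu
      + f0 s * P s * (dA * Gu s + A s * dGu - (dB - g1 s * dA) * al s - (B s - g1 s * A s) * x)"
    using S1 S3 S4 by blast
  have "obstr s = obstr t + (D4 - Gu s * y + P_u s * dmu s
      + P s * (D3 - f0 s * (B s * x + D1) - Fu s * x + P_u s * dxi s))"
    unfolding obstr_def d2_mu_def d2_al_def D al be et using nz by (simp add: t_def algebra_simps)
  moreover have "D4 - Gu s * y + P_u s * dmu s
      + P s * (D3 - f0 s * (B s * x + D1) - Fu s * x + P_u s * dxi s) = - coeff_mu s * dmu s - coeff_xi s * dxi s"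
  proof -
    have e: "al s = et s + A s * g0 s" "be s = ka s + B s * f0 s"
      using nz by (simp_all add: A_def B_def)
    have F: "Fu s = ka s - P s * be s - g1 s * Fv s" "Gv s = et s - P s * al s - f1 s * Gu s"
      by (simp_all add: Fu_def Gv_def P_def)
    show ?thesis
      unfolding D' d F coeff_mu_def coeff_xi_def P_u_def e x_def y_def w_def P_def
      using nz by (simp add: field_simps power2_eq_square)
  qed
  ultimately show ?thesis by (simp add: t_def)
qed

section \<open>Rational functions of the state\<close>

definition fields :: "(state \<Rightarrow> real) set" where
  "fields = {f0, f1, g0, g1, al, ka, mu, be, et, xi, dmu, dxi}"

text \<open>The closure of the coordinates and the constants under ring operations and under division by \<open>F0\<close>, \<open>F1\<close>, \<open>G0\<close>, \<open>G1\<close>. Both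
the smoothness of the charts and the Lipschitz estimate behind uniqueness hold for all such functions
by induction, so that for each derived quantity only membership has to be shown.\<close>
inductive regular :: "(state \<Rightarrow> real) \<Rightarrow> bool" where
  regular_const: "regular (\<lambda>s. c)"
| regular_field: "h \<in> fields \<Longrightarrow> regular h"
| regular_add: "regular h \<Longrightarrow> regular k \<Longrightarrow> regular (\<lambda>s. h s + k s)"
| regular_mult: "regular h \<Longrightarrow> regular k \<Longrightarrow> regular (\<lambda>s. h s * k s)"
| regular_inverse: "h \<in> {f0, f1, g0, g1} \<Longrightarrow> regular (\<lambda>s. inverse (h s))"

lemma regular_minus: "regular h \<Longrightarrow> regular (\<lambda>s. - h s)"
  using regular_mult[OF regular_const[of "-1"], of h] by simp

lemma regular_diff: "regular h \<Longrightarrow> regular k \<Longrightarrow> regular (\<lambda>s. h s - k s)"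
  using regular_add[OF _ regular_minus, of h k] by simp

lemma regular_divide: "regular h \<Longrightarrow> k \<in> {f0, f1, g0, g1} \<Longrightarrow> regular (\<lambda>s. h s / k s)"
  using regular_mult[OF _ regular_inverse, of h k] by (simp add: divide_inverse)

lemma regular_fields: "regular f0" "regular f1" "regular g0" "regular g1" "regular al" "regular ka"
  "regular mu" "regular be" "regular et" "regular xi" "regular dmu" "regular dxi"
  by (simp_all add: regular_field fields_def)

lemma regular_flip: "regular h \<Longrightarrow> regular (\<lambda>s. h (flip s))"
proof (induction rule: regular.induct)
  case (regular_field h)
  then show ?case by (auto simp: fields_def regular_fields)
next
  case (regular_inverse h)
  then show ?case by (auto intro: regular.regular_inverse)
qed (auto intro: regular.intros)

lemmas regular_intros = regular_const regular_fields regular_add regular_mult regular_minus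
  regular_diff regular_divide

lemma regular_P: "regular P"
  and regular_A: "regular A"
  unfolding P_def[abs_def] A_def[abs_def] by (intro regular_intros insertI1 insertI2)+

lemma regular_B: "regular B" unfolding B_def[abs_def] by (rule regular_flip[OF regular_A])
lemma regular_Fv: "regular Fv" unfolding Fv_def[abs_def] by (intro regular_intros insertI1 insertI2)
lemma regular_Gu: "regular Gu" unfolding Gu_def[abs_def] by (rule regular_flip[OF regular_Fv])
lemma regular_Fu: "regular Fu" unfolding Fu_def[abs_def] by (intro regular_intros regular_P regular_Fv)
lemma regular_Gv: "regular Gv" unfolding Gv_def[abs_def] by (rule regular_flip[OF regular_Fu])

lemmas regular_first = regular_intros regular_P regular_A regular_B regular_Fv regular_Gu regular_Fu regular_Gv

lemma regular_S1: "regular S1" unfolding S1_def[abs_def] by (intro regular_first)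
lemma regular_S3: "regular S3" unfolding S3_def[abs_def] by (intro regular_first)
lemma regular_d_al: "regular d_al"
  unfolding d_al_def[abs_def] by (intro regular_first regular_S3 insertI1 insertI2)
lemma regular_d_be: "regular d_be" unfolding d_be_def[abs_def] by (rule regular_flip[OF regular_d_al])
lemma regular_d_et: "regular d_et"
  unfolding d_et_def[abs_def] by (intro regular_first regular_d_al regular_S1 insertI1 insertI2)
lemma regular_d_ka: "regular d_ka" unfolding d_ka_def[abs_def] by (rule regular_flip[OF regular_d_et])

lemmas regular_second = regular_first regular_d_al regular_d_be regular_d_et regular_d_ka

lemma regular_P_u: "regular P_u" unfolding P_u_def[abs_def] by (intro regular_second)
lemma regular_A_u: "regular A_u" unfolding A_u_def[abs_def] by (intro regular_second insertI1 insertI2)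
lemma regular_B_u: "regular B_u" unfolding B_u_def[abs_def] by (intro regular_second insertI1 insertI2)
lemma regular_M_u: "regular M_u" unfolding M_u_def[abs_def] by (intro regular_second)
lemma regular_Fv_u: "regular Fv_u"
  unfolding Fv_u_def[abs_def] by (intro regular_second regular_M_u insertI1 insertI2)
lemma regular_Gu_u: "regular Gu_u"
  unfolding Gu_u_def[abs_def] by (intro regular_second regular_M_u insertI1 insertI2)
lemma regular_Fu_u: "regular Fu_u"
  unfolding Fu_u_def[abs_def] by (intro regular_second regular_P_u regular_Fv_u)
lemma regular_Gv_u: "regular Gv_u"
  unfolding Gv_u_def[abs_def] by (intro regular_second regular_P_u regular_Gu_u)

lemmas regular_third = regular_second regular_P_u regular_A_u regular_B_u regular_Fv_u regular_Gu_u
  regular_Fu_u regular_Gv_u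

lemma regular_S1_u: "regular S1_u" unfolding S1_u_def[abs_def] by (intro regular_third)
lemma regular_S3_u: "regular S3_u" unfolding S3_u_def[abs_def] by (intro regular_third)
lemma regular_S4_u: "regular S4_u" unfolding S4_u_def[abs_def] by (intro regular_third)
lemma regular_d2_al: "regular d2_al" unfolding d2_al_def[abs_def] by (intro regular_third regular_S1_u)
lemma regular_d2_mu: "regular d2_mu"
  unfolding d2_mu_def[abs_def] by (intro regular_third regular_S3_u regular_d2_al)
lemma regular_obstr: "regular obstr"
  unfolding obstr_def[abs_def] by (intro regular_third regular_S4_u regular_d2_mu)

definition valid :: "state \<Rightarrow> bool" where
  "valid s \<longleftrightarrow> f0 s \<noteq> 0 \<and> f1 s \<noteq> 0 \<and> g0 s \<noteq> 0 \<and> g1 s \<noteq> 0 \<and> P s \<noteq> 1"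

lemma valid_flip [simp]: "valid (flip s) = valid s"
  by (auto simp: valid_def)

definition smooth_family :: "'a::euclidean_space set \<Rightarrow> ('a \<Rightarrow> state) \<Rightarrow> bool" where
  "smooth_family U \<sigma> \<longleftrightarrow> open U \<and> (\<forall>x\<in>U. valid (\<sigma> x)) \<and> (\<forall>h\<in>fields. smooth_on U (\<lambda>x. h (\<sigma> x)))"

lemma regular_smooth:
  assumes "regular h" "smooth_family U \<sigma>"
  shows "smooth_on U (\<lambda>x. h (\<sigma> x))"
  using assms(1)
proof (induction rule: regular.induct)
  case (regular_inverse h)
  then show ?case using assms(2)
    by (intro smooth_on_inverse) (auto simp: smooth_family_def fields_def valid_def)
qed (use assms(2) in \<open>auto simp: smooth_family_def intro: smooth_on_const smooth_on_add smooth_on_mult\<close>)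

section \<open>Coordinates adapted to the two conditions\<close>

text \<open>The inverse of the map sending a state to \<open>F0, F1, G0, G1\<close>, the derivatives \<open>m = F0,v\<close> and \<open>n = G0,u\<close>,
the four coefficients \<open>q1, \<dots>, q4\<close> of the two affine conditions, and \<open>\<mu>', \<xi>'\<close>. The combinations \<open>q1 + p q2\<close> and
\<open>q3 + p q4\<close> are free of \<open>\<eta>\<close> and \<open>\<kappa>\<close>; corrected by their terms in \<open>m\<close> and \<open>n\<close> they are \<open>w1, w2\<close>,
linear in \<open>A\<close> and \<open>B\<close> (here \<open>a\<close> and \<open>b\<close>). Then \<open>q2\<close> gives \<open>\<eta>\<close>, \<open>q4\<close> gives \<open>\<kappa>\<close>, and \<open>m\<close> and \<open>n\<close> give \<open>\<mu>\<close> and \<open>\<xi>\<close>.\<close>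
definition state_of :: "real \<Rightarrow> real \<Rightarrow> real \<Rightarrow> real \<Rightarrow> real \<Rightarrow> real \<Rightarrow> real \<Rightarrow> real \<Rightarrow> real \<Rightarrow> real
    \<Rightarrow> real \<Rightarrow> real \<Rightarrow> state" where
  "state_of x0 x1 y0 y1 m n q1 q2 q3 q4 r t = (
    let p = x1 * y1;
        w1 = q1 + p * q2 - (1 - p\<^sup>2) * y1 * m / x0;
        w2 = q3 + p * q4 - (1 - p\<^sup>2) * x1 * n / y0;
        d = - p * (p - 1)\<^sup>2 * (p\<^sup>2 + 3 * p + 4);
        a = (x1 * (p + 3) * w1 + (p\<^sup>2 + p + 2) * w2) / d;
        b = (y1 * (p + 3) * w2 + (p\<^sup>2 + p + 2) * w1) / d;
        e = ((q2 - y1 * a + p\<^sup>2 * b + p * y1 * m / x0) * y0 + p * n) / (y1 * (1 - p));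
        k = ((q4 - x1 * b + p\<^sup>2 * a + p * x1 * n / y0) * x0 + p * m) / (x1 * (1 - p))
    in \<lparr>f0 = x0, f1 = x1, g0 = y0, g1 = y1, al = e + a * y0, ka = k,
        mu = (y0 * m + x1 * x0 * n) / (1 - p) - (e + a * y0) * x0, be = k + b * x0, et = e,
        xi = (x0 * n + y1 * y0 * m) / (1 - p) - (k + b * x0) * y0, dmu = r, dxi = t\<rparr>)"

text \<open>This factor of the determinant of the linear system for \<open>A\<close> and \<open>B\<close> has negative discriminant. The other
factors are powers of \<open>p\<close> and \<open>p - 1\<close>, so the system is solvable when \<open>p\<close> is neither \<open>0\<close> nor \<open>1\<close>.\<close>
lemma quadratic_pos: "p\<^sup>2 + 3 * p + 4 > (0::real)"
proof -
  have "p\<^sup>2 + 3 * p + 4 = (p + 3/2)\<^sup>2 + 7/4" by (simp add: power2_eq_square algebra_simps)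
  then show ?thesis by (metis add_nonneg_pos zero_le_power2 zero_less_divide_iff zero_less_numeral)
qed

text \<open>Cramer's rule for the two linear equations for \<open>A\<close> and \<open>B\<close>.\<close>
lemma state_of_A:
  assumes "valid s"
  shows "d = - P s * (P s - 1)\<^sup>2 * ((P s)\<^sup>2 + 3 * P s + 4) \<Longrightarrow>
    w1 = coeff_mu s + P s * coeff_xi s - (1 - (P s)\<^sup>2) * g1 s * Fv s / f0 s \<Longrightarrow>
    w2 = coeff_mu (flip s) + P s * coeff_xi (flip s) - (1 - (P s)\<^sup>2) * f1 s * Gu s / g0 s \<Longrightarrow>
    (f1 s * (P s + 3) * w1 + ((P s)\<^sup>2 + P s + 2) * w2) / d = A s"
proof -
  assume d: "d = - P s * (P s - 1)\<^sup>2 * ((P s)\<^sup>2 + 3 * P s + 4)"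
    and w: "w1 = coeff_mu s + P s * coeff_xi s - (1 - (P s)\<^sup>2) * g1 s * Fv s / f0 s"
    "w2 = coeff_mu (flip s) + P s * coeff_xi (flip s) - (1 - (P s)\<^sup>2) * f1 s * Gu s / g0 s"
  have nz: "f0 s \<noteq> 0" "f1 s \<noteq> 0" "g0 s \<noteq> 0" "g1 s \<noteq> 0" "P s \<noteq> 1" "P s \<noteq> 0"
    using assms by (auto simp: valid_def P_def)
  have "d \<noteq> 0" using nz quadratic_pos[of "P s"] by (simp add: d)
  have w1: "w1 = P s * (P s + 3) * g1 s * A s - P s * ((P s)\<^sup>2 + P s + 2) * B s"
    unfolding w coeff_mu_def coeff_xi_def using nz by (simp add: field_simps power2_eq_square)
  have w2: "w2 = P s * (P s + 3) * f1 s * B s - P s * ((P s)\<^sup>2 + P s + 2) * A s"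
    unfolding w coeff_mu_def coeff_xi_def flip_simps flip_derived using nz by (simp add: field_simps power2_eq_square)
  have "f1 s * (P s + 3) * w1 + ((P s)\<^sup>2 + P s + 2) * w2 = d * A s"
    unfolding w1 w2 d by (simp add: P_def algebra_simps power2_eq_square)
  then show ?thesis using \<open>d \<noteq> 0\<close> by simp
qed

lemma state_of_et:
  assumes "valid s"
  shows "((coeff_xi s - g1 s * A s + (P s)\<^sup>2 * B s + P s * g1 s * Fv s / f0 s) * g0 s + P s * Gu s)
    / (g1 s * (1 - P s)) = et s"
  using assms unfolding valid_def coeff_xi_def by (simp add: field_simps)

text \<open>The definitions of \<open>F0,v\<close> and \<open>G0,u\<close> are linear equations for \<open>\<mu> + \<alpha> F0\<close> and \<open>\<xi> + \<beta> G0\<close> with determinant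
\<open>1 - F1 G1\<close>.\<close>
lemma state_of_mu:
  assumes "valid s"
  shows "(g0 s * Fv s + f1 s * f0 s * Gu s) / (1 - P s) - (et s + A s * g0 s) * f0 s = mu s"
proof -
  have nz: "f0 s \<noteq> 0" "g0 s \<noteq> 0" "1 - P s \<noteq> 0" using assms by (auto simp: valid_def)
  have al: "et s + A s * g0 s = al s" using nz by (simp add: A_def)
  have F: "g0 s * Fv s = mu s + al s * f0 s - (xi s + be s * g0 s) * f1 s" using nz by (simp add: Fv_def)
  have G: "f0 s * Gu s = xi s + be s * g0 s - (mu s + al s * f0 s) * g1 s"
    using nz by (simp add: Gu_def Fv_def)
  have "g0 s * Fv s + f1 s * f0 s * Gu s = (mu s + al s * f0 s) * (1 - P s)"
    unfolding mult.assoc F G by (simp add: P_def algebra_simps)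
  then show ?thesis using nz al by simp
qed

lemma state_of_surj:
  assumes "valid s"
  shows "s = state_of (f0 s) (f1 s) (g0 s) (g1 s) (Fv s) (Gu s) (coeff_mu s) (coeff_xi s) (coeff_mu (flip s)) (coeff_xi (flip s))
    (dmu s) (dxi s)"
proof -
  have f: "valid (flip s)" using assms by simp
  have 1: "g1 s * f1 s = P s" "f1 s * g1 s = P s" by (simp_all add: P_def)
  note A = state_of_A[OF assms refl refl refl] and B = state_of_A[OF f refl refl refl, unfolded flip_simps flip_derived]
  note e = state_of_et[OF assms] and k = state_of_et[OF f, unfolded flip_simps flip_derived]
  note m = state_of_mu[OF assms] and x = state_of_mu[OF f, unfolded flip_simps flip_derived]
  have nz: "f0 s \<noteq> 0" "g0 s \<noteq> 0" using assms by (auto simp: valid_def)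
  have al: "et s + A s * g0 s = al s" "ka s + B s * f0 s = be s" using nz by (simp_all add: A_def B_def)
  show ?thesis
    unfolding state_of_def Let_def 1 A B e k al
    by (rule state.equality) (simp_all add: m[unfolded al] x[unfolded al])
qed

lemma base_state_of:
  "base (state_of x0 x1 y0 y1 m n q1 q2 q3 q4 r t) = state_of x0 x1 y0 y1 m n q1 q2 q3 q4 0 0"
  by (simp add: state_of_def Let_def base_def)

lemma coeff_base [simp]: "coeff_mu (base s) = coeff_mu s" "coeff_xi (base s) = coeff_xi s"
  by (simp_all add: coeff_mu_def coeff_xi_def)

lemma smooth_state_of:
  assumes U: "open U" and nz: "\<And>x. x \<in> U \<Longrightarrow> x0 x \<noteq> 0 \<and> x1 x \<noteq> 0 \<and> y0 x \<noteq> 0 \<and> y1 x \<noteq> 0 \<and> x1 x * y1 x \<noteq> 1"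
    and sm: "smooth_on U x0" "smooth_on U x1" "smooth_on U y0" "smooth_on U y1" "smooth_on U m" "smooth_on U n"
      "smooth_on U q1" "smooth_on U q2" "smooth_on U q3" "smooth_on U q4" "smooth_on U r" "smooth_on U t"
  shows "smooth_family U (\<lambda>x. state_of (x0 x) (x1 x) (y0 x) (y1 x) (m x) (n x) (q1 x) (q2 x) (q3 x) (q4 x) (r x) (t x))"
proof -
  note ints = smooth_on_const smooth_on_add[OF U] smooth_on_mult[OF U] smooth_on_diff[OF U]
    smooth_on_minus[OF U] smooth_on_power[OF U] smooth_on_divide[OF U]
  define p where "p = (\<lambda>x. x1 x * y1 x)"
  define w1 where "w1 = (\<lambda>x. q1 x + p x * q2 x - (1 - (p x)\<^sup>2) * y1 x * m x / x0 x)"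
  define w2 where "w2 = (\<lambda>x. q3 x + p x * q4 x - (1 - (p x)\<^sup>2) * x1 x * n x / y0 x)"
  define d where "d = (\<lambda>x. - p x * (p x - 1)\<^sup>2 * ((p x)\<^sup>2 + 3 * p x + 4))"
  define a where "a = (\<lambda>x. (x1 x * (p x + 3) * w1 x + ((p x)\<^sup>2 + p x + 2) * w2 x) / d x)"
  define b where "b = (\<lambda>x. (y1 x * (p x + 3) * w2 x + ((p x)\<^sup>2 + p x + 2) * w1 x) / d x)"
  define e where "e = (\<lambda>x. ((q2 x - y1 x * a x + (p x)\<^sup>2 * b x + p x * y1 x * m x / x0 x) * y0 x + p x * n x) / (y1 x * (1 - p x)))"
  define k where "k = (\<lambda>x. ((q4 x - x1 x * b x + (p x)\<^sup>2 * a x + p x * x1 x * n x / y0 x) * x0 x + p x * m x) / (x1 x * (1 - p x)))"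
  have nz': "x0 x \<noteq> 0" "x1 x \<noteq> 0" "y0 x \<noteq> 0" "y1 x \<noteq> 0" "p x \<noteq> 1" "p x \<noteq> 0" "1 - p x \<noteq> 0" "d x \<noteq> 0"
    if "x \<in> U" for x
    using nz[OF that] quadratic_pos[of "p x"] by (auto simp: p_def d_def)
  have p: "smooth_on U p" unfolding p_def by (intro ints sm)
  have w: "smooth_on U w1" "smooth_on U w2" unfolding w1_def w2_def by (intro ints sm p nz'; assumption)+
  have d: "smooth_on U d" unfolding d_def by (intro ints p)
  have ab: "smooth_on U a" "smooth_on U b" unfolding a_def b_def by (intro ints sm p w d nz'; assumption)+
  have ek: "smooth_on U e" "smooth_on U k" unfolding e_def k_def
    by (intro ints sm p ab nz' no_zero_divisors; assumption)+
  have th: "state_of (x0 x) (x1 x) (y0 x) (y1 x) (m x) (n x) (q1 x) (q2 x) (q3 x) (q4 x) (r x) (t x) =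
     \<lparr>f0 = x0 x, f1 = x1 x, g0 = y0 x, g1 = y1 x, al = e x + a x * y0 x, ka = k x,
        mu = (y0 x * m x + x1 x * x0 x * n x) / (1 - p x) - (e x + a x * y0 x) * x0 x,
        be = k x + b x * x0 x, et = e x,
        xi = (x0 x * n x + y1 x * y0 x * m x) / (1 - p x) - (k x + b x * x0 x) * y0 x, dmu = r x, dxi = t x\<rparr>" for x
    by (simp only: state_of_def Let_def k_def e_def a_def b_def d_def w1_def w2_def p_def)
  have "smooth_on U (\<lambda>x. (y0 x * m x + x1 x * x0 x * n x) / (1 - p x) - (e x + a x * y0 x) * x0 x)"
    "smooth_on U (\<lambda>x. (x0 x * n x + y1 x * y0 x * m x) / (1 - p x) - (k x + b x * x0 x) * y0 x)"
    "smooth_on U (\<lambda>x. e x + a x * y0 x)" "smooth_on U (\<lambda>x. k x + b x * x0 x)"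
    by (intro ints sm p ab ek nz'; assumption)+
  then show ?thesis
    unfolding smooth_family_def th fields_def
    using U nz sm ek by (simp add: valid_def P_def)
qed

lemma smooth_family_flip:
  assumes "smooth_family U \<sigma>"
  shows "smooth_family U (\<lambda>x. flip (\<sigma> x))"
  using assms regular_smooth[OF regular_flip[OF regular_field] assms]
  by (auto simp: smooth_family_def)

section \<open>Covering the admissible 1-jets by charts\<close>

text \<open>The entries are in the order of \<open>components\<close>. The \<open>u\<close>-derivatives of functions of \<open>v\<close>, and
conversely, are the zeros.\<close>
definition jet_row :: "nat \<Rightarrow> nat \<Rightarrow> (state \<Rightarrow> real) list" where
  "jet_row i j =
    (if j = 1 then [Fv, \<lambda>s. f1 s * A s, Gv, \<lambda>s. - P s * B s, \<lambda>s. 0, \<lambda>s. 0, \<lambda>s. 0, d_be, d_et, dxi]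
     else if i = 1 then [Fu, \<lambda>s. - P s * A s, Gu, \<lambda>s. g1 s * B s, d_al, d_ka, dmu, \<lambda>s. 0, \<lambda>s. 0, \<lambda>s. 0]
     else [f0, f1, g0, g1, al, ka, mu, be, et, xi])"

definition jet_of :: "state \<Rightarrow> nat \<times> nat \<times> nat \<Rightarrow> real" where
  "jet_of s = (\<lambda>(c, i, j). if c < 10 \<and> i + j \<le> 1 then (jet_row i j ! c) s else 0)"

lemma regular_jet_row: "\<forall>h\<in>set (jet_row i j). regular h"
  by (auto simp: jet_row_def intro!: regular_second)

lemma length_jet_row: "length (jet_row i j) = 10"
  by (simp add: jet_row_def)

lemma smooth_jet_of:
  assumes "smooth_family U \<sigma>"
  shows "smooth_on U (\<lambda>x. jet_of (\<sigma> x) k)"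
proof -
  obtain c i j where k: "k = (c, i, j)" by (cases k)
  have "regular (jet_row i j ! c)" if "c < 10"
    using regular_jet_row length_jet_row that nth_mem by metis
  with regular_smooth[OF _ assms] show ?thesis
    unfolding jet_of_def k prod.case
    by (cases "c < 10 \<and> i + j \<le> 1") (simp_all only: if_True if_False simp_thms smooth_on_const)
qed

text \<open>The charts of the two coverings are enumerated alternately.\<close>
lemma dim_at_most_Un:
  fixes d :: "'d::finite itself"
  assumes "dim_at_most d S" "dim_at_most d T"
  shows "dim_at_most d (S \<union> T)"
proof -
  obtain U :: "nat \<Rightarrow> (real ^ 'd) set" and \<phi>
    where U: "\<forall>n. open (U n) \<and> (\<forall>i. smooth_on (U n) (\<lambda>x. \<phi> n x i))" "S \<subseteq> (\<Union>n. \<phi> n ` U n)"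
    using assms(1) unfolding dim_at_most_def by blast
  obtain V :: "nat \<Rightarrow> (real ^ 'd) set" and \<psi>
    where V: "\<forall>n. open (V n) \<and> (\<forall>i. smooth_on (V n) (\<lambda>x. \<psi> n x i))" "T \<subseteq> (\<Union>n. \<psi> n ` V n)"
    using assms(2) unfolding dim_at_most_def by blast
  have S: "\<exists>n. y \<in> (if even n then \<phi> (n div 2) else \<psi> (n div 2)) ` (if even n then U (n div 2) else V (n div 2))"
    if y: "y \<in> S \<union> T" for y
  proof -
    from y consider n where "y \<in> \<phi> n ` U n" | n where "y \<in> \<psi> n ` V n" using U(2) V(2) by blast
    then show ?thesis
    proof cases
      case (1 n) then show ?thesis by (intro exI[of _ "2 * n"]) simp
    next
      case (2 n) then show ?thesis by (intro exI[of _ "2 * n + 1"]) simp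
    qed
  qed
  show ?thesis unfolding dim_at_most_def
    by (rule exI[of _ "\<lambda>n. if even n then U (n div 2) else V (n div 2)"],
        rule exI[of _ "\<lambda>n. if even n then \<phi> (n div 2) else \<psi> (n div 2)"])
      (use U(1) V(1) S in auto)
qed

lemma dim_at_most_mono: "dim_at_most d T \<Longrightarrow> S \<subseteq> T \<Longrightarrow> dim_at_most d S"
  unfolding dim_at_most_def by blast

lemma dim_at_most_chart:
  fixes \<sigma> :: "real ^ 'd \<Rightarrow> state"
  assumes "smooth_family U \<sigma>" "S \<subseteq> \<sigma> ` U"
  shows "dim_at_most TYPE('d) (jet_of ` S)"
  unfolding dim_at_most_def
proof (intro exI conjI allI)
  show "open U" using assms by (simp add: smooth_family_def)
  show "smooth_on U (\<lambda>x. jet_of (\<sigma> x) i)" for i by (rule smooth_jet_of[OF assms(1)])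
  show "jet_of ` S \<subseteq> (\<Union>n::nat. (\<lambda>x. jet_of (\<sigma> x)) ` U)" using assms(2) by blast
qed

lemma ex_vec10:
  "\<exists>x::real^10. x $ 1 = a1 \<and> x $ 2 = a2 \<and> x $ 3 = a3 \<and> x $ 4 = a4 \<and> x $ 5 = a5 \<and> x $ 6 = a6 \<and>
     x $ 7 = a7 \<and> x $ 8 = a8 \<and> x $ 9 = a9 \<and> x $ 10 = a10"
  by (rule exI[of _ "\<chi> i. if i = 1 then a1 else if i = 2 then a2 else if i = 3 then a3 else
    if i = 4 then a4 else if i = 5 then a5 else if i = 6 then a6 else if i = 7 then a7 else
    if i = 8 then a8 else if i = 9 then a9 else a10"]) simp

lemma smooth_on_nth: "smooth_on U (\<lambda>x::real^10. x $ i)"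
  by (rule smooth_on_linear) (rule bounded_linear_vec_nth)

text \<open>The conditions that the existence of a solution imposes on its state at the base point. They need not be
sufficient, but they already cut the dimension down from twelve to ten.\<close>
definition admissible :: "state set" where
  "admissible = {s. valid s \<and> obstr s = 0 \<and> obstr (flip s) = 0}"

lemma admissible_flip: "flip s \<in> admissible \<longleftrightarrow> s \<in> admissible"
  by (auto simp: admissible_def)

text \<open>The two obstructions form a linear system of two equations for \<open>\<mu>'\<close> and \<open>\<xi>'\<close> whose matrix and right-hand
side are functions of the ten remaining coordinates.\<close>
lemma admissible_linear:
  assumes "s \<in> admissible"
  shows "coeff_mu s * dmu s + coeff_xi s * dxi s = obstr (base s)"
    and "coeff_xi (flip s) * dmu s + coeff_mu (flip s) * dxi s = obstr (flip (base s))"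
  using assms obstr_affine[of s] obstr_affine[of "flip s"]
  by (auto simp: admissible_def valid_def flip_base)

definition nondeg10 :: "(real ^ 10) set" where
  "nondeg10 = {x. x $ 1 \<noteq> 0 \<and> x $ 2 \<noteq> 0 \<and> x $ 3 \<noteq> 0 \<and> x $ 4 \<noteq> 0 \<and> x $ 2 * x $ 4 \<noteq> 1}"

lemma open_nondeg10: "open nondeg10"
  unfolding nondeg10_def by (intro open_Collect_conj open_Collect_neq continuous_intros)

abbreviation state10 :: "real ^ 10 \<Rightarrow> real \<Rightarrow> real \<Rightarrow> real \<Rightarrow> real \<Rightarrow> real \<Rightarrow> real \<Rightarrow> state" where
  "state10 x \<equiv> state_of (x $ 1) (x $ 2) (x $ 3) (x $ 4) (x $ 5) (x $ 6)"

lemma smooth_state10: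
  assumes "open U" "U \<subseteq> nondeg10" "smooth_on U q1" "smooth_on U q2" "smooth_on U q3" "smooth_on U q4"
    "smooth_on U r" "smooth_on U t"
  shows "smooth_family U (\<lambda>x. state10 x (q1 x) (q2 x) (q3 x) (q4 x) (r x) (t x))"
  by (rule smooth_state_of) (use assms in \<open>auto intro: smooth_on_nth simp: nondeg10_def\<close>)

lemma state10_surj:
  assumes "valid s"
  obtains x where "x \<in> nondeg10" "x $ 7 = a" "x $ 8 = b" "x $ 9 = c" "x $ 10 = d"
    "s = state10 x (coeff_mu s) (coeff_xi s) (coeff_mu (flip s)) (coeff_xi (flip s)) (dmu s) (dxi s)"
    "base s = state10 x (coeff_mu s) (coeff_xi s) (coeff_mu (flip s)) (coeff_xi (flip s)) 0 0"
proof -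
  obtain x :: "real ^ 10" where x: "x $ 1 = f0 s" "x $ 2 = f1 s" "x $ 3 = g0 s" "x $ 4 = g1 s"
    "x $ 5 = Fv s" "x $ 6 = Gu s" "x $ 7 = a" "x $ 8 = b" "x $ 9 = c" "x $ 10 = d"
    using ex_vec10 by metis
  show ?thesis
  proof (rule that[of x])
    show "x \<in> nondeg10" using assms x by (auto simp: nondeg10_def valid_def P_def)
    show s: "s = state10 x (coeff_mu s) (coeff_xi s) (coeff_mu (flip s)) (coeff_xi (flip s)) (dmu s) (dxi s)"
      unfolding x by (rule state_of_surj[OF assms])
    show "base s = state10 x (coeff_mu s) (coeff_xi s) (coeff_mu (flip s)) (coeff_xi (flip s)) 0 0"
      by (subst s) (simp add: base_state_of)
  qed (use x in auto)
qed

text \<open>Where the matrix is invertible, \<open>\<mu>'\<close> and \<open>\<xi>'\<close> are determined by the other ten coordinates.\<close>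
lemma dim_regular_rank:
  "dim_at_most TYPE(10) (jet_of ` {s \<in> admissible. coeff_mu s * coeff_mu (flip s) \<noteq> coeff_xi s * coeff_xi (flip s)})"
proof (rule dim_at_most_chart)
  \<comment> \<open>Coordinates 7 to 10 are the four coefficients, and \<open>d\<close> is the determinant in Cramer's rule.\<close>
  define U :: "(real ^ 10) set" where "U = nondeg10 \<inter> {x. x $ 7 * x $ 9 \<noteq> x $ 8 * x $ 10}"
  define \<sigma> where "\<sigma> x = state10 x (x $ 7) (x $ 8) (x $ 9) (x $ 10) 0 0" for x
  define d where "d x = x $ 7 * x $ 9 - x $ 8 * x $ 10" for x :: "real ^ 10"
  have U: "open U" unfolding U_def
    by (intro open_Int open_nondeg10 open_Collect_neq continuous_intros)
  have sub: "U \<subseteq> nondeg10" by (auto simp: U_def)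
  note ints = smooth_on_const smooth_on_nth smooth_on_add[OF U] smooth_on_mult[OF U] smooth_on_diff[OF U]
    smooth_on_divide[OF U]
  have \<sigma>: "smooth_family U \<sigma>" unfolding \<sigma>_def
    by (rule smooth_state10[OF U sub]; intro ints)
  note c = regular_smooth[OF regular_obstr \<sigma>] regular_smooth[OF regular_obstr smooth_family_flip[OF \<sigma>]]
  have d: "smooth_on U d" "x \<in> U \<Longrightarrow> d x \<noteq> 0" for x
    unfolding d_def by (intro ints) (auto simp: U_def)
  show "smooth_family U (\<lambda>x. state10 x (x $ 7) (x $ 8) (x $ 9) (x $ 10)
      ((x $ 9 * obstr (\<sigma> x) - x $ 8 * obstr (flip (\<sigma> x))) / d x)
      ((x $ 7 * obstr (flip (\<sigma> x)) - x $ 10 * obstr (\<sigma> x)) / d x))" (is "smooth_family U ?\<tau>")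
    by (rule smooth_state10[OF U sub]; intro ints c d)
  show "{s \<in> admissible. coeff_mu s * coeff_mu (flip s) \<noteq> coeff_xi s * coeff_xi (flip s)} \<subseteq> ?\<tau> ` U"
  proof safe
    fix s assume s: "s \<in> admissible" and ne: "coeff_mu s * coeff_mu (flip s) \<noteq> coeff_xi s * coeff_xi (flip s)"
    then obtain x where x: "x \<in> nondeg10" "x $ 7 = coeff_mu s" "x $ 8 = coeff_xi s" "x $ 9 = coeff_mu (flip s)" "x $ 10 = coeff_xi (flip s)"
      "s = state10 x (coeff_mu s) (coeff_xi s) (coeff_mu (flip s)) (coeff_xi (flip s)) (dmu s) (dxi s)"
      "base s = state10 x (coeff_mu s) (coeff_xi s) (coeff_mu (flip s)) (coeff_xi (flip s)) 0 0"
      by (auto simp: admissible_def elim: state10_surj)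
    have \<sigma>x: "\<sigma> x = base s" using x by (simp add: \<sigma>_def)
    have dx: "d x \<noteq> 0" "d x = coeff_mu s * coeff_mu (flip s) - coeff_xi s * coeff_xi (flip s)" using ne x by (simp_all add: d_def)
    have "x $ 9 * obstr (\<sigma> x) - x $ 8 * obstr (flip (\<sigma> x)) = d x * dmu s"
      "x $ 7 * obstr (flip (\<sigma> x)) - x $ 10 * obstr (\<sigma> x) = d x * dxi s"
      unfolding \<sigma>x admissible_linear[OF s, symmetric] x(2-5) dx(2) by (simp_all add: algebra_simps)
    with dx(1) have \<tau>x: "?\<tau> x = state10 x (coeff_mu s) (coeff_xi s) (coeff_mu (flip s)) (coeff_xi (flip s)) (dmu s) (dxi s)"
      using x(2-5) by simp
    have "x \<in> U" using x ne by (simp add: U_def)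
    then show "s \<in> ?\<tau> ` U" by (rule image_eqI[where x = x, rotated]) (rule trans[OF x(6) \<tau>x[symmetric]])
  qed
qed

text \<open>Where the matrix is singular and its first entry is nonzero, its second row is a multiple \<open>t\<close> of
the first. The entries of the first row and \<open>t\<close> replace four entries by three parameters, and the first equation
leaves one free unknown: with \<open>F0, F1, G0, G1, m, n\<close> this makes \<open>6 + 3 + 1\<close> parameters. The flipped chart covers the
states where the last entry is nonzero.\<close>
lemma dim_first_entry:
  "dim_at_most TYPE(10) (jet_of ` {s \<in> admissible. coeff_mu s * coeff_mu (flip s) = coeff_xi s * coeff_xi (flip s) \<and> coeff_mu s \<noteq> 0})"
    (is "dim_at_most _ (_ ` ?S)")
  and dim_first_entry_flip:
  "dim_at_most TYPE(10) (jet_of ` flip `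
     {s \<in> admissible. coeff_mu s * coeff_mu (flip s) = coeff_xi s * coeff_xi (flip s) \<and> coeff_mu s \<noteq> 0})"
proof -
  \<comment> \<open>Coordinates 7 and 8 are the first row, 9 is the ratio of the rows, 10 is \<open>\<xi>'\<close>.\<close>
  define U :: "(real ^ 10) set" where "U = nondeg10 \<inter> {x. x $ 7 \<noteq> 0}"
  then have nz: "x $ 7 \<noteq> 0" if "x \<in> U" for x using that by auto
  define \<sigma> where "\<sigma> x = state10 x (x $ 7) (x $ 8) (x $ 9 * x $ 8) (x $ 9 * x $ 7) 0 0" for x
  have U: "open U" unfolding U_def
    by (intro open_Int open_nondeg10 open_Collect_neq continuous_intros)
  have sub: "U \<subseteq> nondeg10" by (auto simp: U_def)
  note ints = smooth_on_const smooth_on_nth smooth_on_add[OF U] smooth_on_mult[OF U] smooth_on_diff[OF U]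
    smooth_on_divide[OF U]
  have \<sigma>: "smooth_family U \<sigma>" unfolding \<sigma>_def
    by (rule smooth_state10[OF U sub]; intro ints)
  note c = regular_smooth[OF regular_obstr \<sigma>]
  define \<tau> where "\<tau> x = state10 x (x $ 7) (x $ 8) (x $ 9 * x $ 8) (x $ 9 * x $ 7)
      ((obstr (\<sigma> x) - x $ 8 * x $ 10) / x $ 7) (x $ 10)" for x
  have \<tau>: "smooth_family U \<tau>" unfolding \<tau>_def
    by (rule smooth_state10[OF U sub]; intro ints c nz)
  have cover: "?S \<subseteq> \<tau> ` U"
  proof safe
    fix s assume s: "s \<in> admissible" and eq: "coeff_mu s * coeff_mu (flip s) = coeff_xi s * coeff_xi (flip s)" "coeff_mu s \<noteq> 0"
    then obtain x where x: "x \<in> nondeg10" "x $ 7 = coeff_mu s" "x $ 8 = coeff_xi s" "x $ 9 = coeff_xi (flip s) / coeff_mu s" "x $ 10 = dxi s"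
      "s = state10 x (coeff_mu s) (coeff_xi s) (coeff_mu (flip s)) (coeff_xi (flip s)) (dmu s) (dxi s)"
      "base s = state10 x (coeff_mu s) (coeff_xi s) (coeff_mu (flip s)) (coeff_xi (flip s)) 0 0"
      by (auto simp: admissible_def elim: state10_surj)
    have q: "x $ 9 * x $ 8 = coeff_mu (flip s)" "x $ 9 * x $ 7 = coeff_xi (flip s)"
      using eq by (simp_all add: x(2-4) nonzero_divide_eq_eq mult.commute)
    have \<sigma>x: "\<sigma> x = base s" by (simp only: \<sigma>_def q[unfolded x(2,3)] x(2,3,7))
    have "obstr (\<sigma> x) - x $ 8 * x $ 10 = coeff_mu s * dmu s"
      unfolding \<sigma>x admissible_linear[OF s, symmetric] x(2-5) by simp
    then have \<tau>x: "\<tau> x = state10 x (coeff_mu s) (coeff_xi s) (coeff_mu (flip s)) (coeff_xi (flip s)) (dmu s) (dxi s)"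
      unfolding \<tau>_def q using x(2-5) eq by simp
    have "x \<in> U" using x eq by (simp add: U_def)
    then show "s \<in> \<tau> ` U" by (rule image_eqI[where x = x, rotated]) (rule trans[OF x(6) \<tau>x[symmetric]])
  qed
  show "dim_at_most TYPE(10) (jet_of ` ?S)" by (rule dim_at_most_chart[OF \<tau> cover])
  show "dim_at_most TYPE(10) (jet_of ` flip ` ?S)"
    by (rule dim_at_most_chart[OF smooth_family_flip[OF \<tau>]]) (use cover in blast)
qed

text \<open>The same count as for a nonzero first entry; the first equation is now solved for \<open>\<xi>'\<close>.\<close>
lemma dim_second_entry:
  "dim_at_most TYPE(10) (jet_of ` {s \<in> admissible. coeff_mu s * coeff_mu (flip s) = coeff_xi s * coeff_xi (flip s) \<and> coeff_xi s \<noteq> 0})"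
    (is "dim_at_most _ (_ ` ?S)")
  and dim_second_entry_flip:
  "dim_at_most TYPE(10) (jet_of ` flip `
     {s \<in> admissible. coeff_mu s * coeff_mu (flip s) = coeff_xi s * coeff_xi (flip s) \<and> coeff_xi s \<noteq> 0})"
proof -
  \<comment> \<open>Coordinates 7 and 8 are the first row, 9 is the ratio of the rows, 10 is \<open>\<mu>'\<close>.\<close>
  define U :: "(real ^ 10) set" where "U = nondeg10 \<inter> {x. x $ 8 \<noteq> 0}"
  then have nz: "x $ 8 \<noteq> 0" if "x \<in> U" for x using that by auto
  define \<sigma> where "\<sigma> x = state10 x (x $ 7) (x $ 8) (x $ 9 * x $ 8) (x $ 9 * x $ 7) 0 0" for x
  have U: "open U" unfolding U_def
    by (intro open_Int open_nondeg10 open_Collect_neq continuous_intros)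
  have sub: "U \<subseteq> nondeg10" by (auto simp: U_def)
  note ints = smooth_on_const smooth_on_nth smooth_on_add[OF U] smooth_on_mult[OF U] smooth_on_diff[OF U]
    smooth_on_divide[OF U]
  have \<sigma>: "smooth_family U \<sigma>" unfolding \<sigma>_def
    by (rule smooth_state10[OF U sub]; intro ints)
  note c = regular_smooth[OF regular_obstr \<sigma>]
  define \<tau> where "\<tau> x = state10 x (x $ 7) (x $ 8) (x $ 9 * x $ 8) (x $ 9 * x $ 7)
      (x $ 10) ((obstr (\<sigma> x) - x $ 7 * x $ 10) / x $ 8)" for x
  have \<tau>: "smooth_family U \<tau>" unfolding \<tau>_def
    by (rule smooth_state10[OF U sub]; intro ints c nz)
  have cover: "?S \<subseteq> \<tau> ` U"
  proof safe
    fix s assume s: "s \<in> admissible" and eq: "coeff_mu s * coeff_mu (flip s) = coeff_xi s * coeff_xi (flip s)" "coeff_xi s \<noteq> 0"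
    then obtain x where x: "x \<in> nondeg10" "x $ 7 = coeff_mu s" "x $ 8 = coeff_xi s" "x $ 9 = coeff_mu (flip s) / coeff_xi s" "x $ 10 = dmu s"
      "s = state10 x (coeff_mu s) (coeff_xi s) (coeff_mu (flip s)) (coeff_xi (flip s)) (dmu s) (dxi s)"
      "base s = state10 x (coeff_mu s) (coeff_xi s) (coeff_mu (flip s)) (coeff_xi (flip s)) 0 0"
      by (auto simp: admissible_def elim: state10_surj)
    have q: "x $ 9 * x $ 8 = coeff_mu (flip s)" "x $ 9 * x $ 7 = coeff_xi (flip s)"
      using eq by (simp_all add: x(2-4) nonzero_divide_eq_eq mult.commute)
    have \<sigma>x: "\<sigma> x = base s" by (simp only: \<sigma>_def q[unfolded x(2,3)] x(2,3,7))
    have "obstr (\<sigma> x) - x $ 7 * x $ 10 = coeff_xi s * dxi s"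
      unfolding \<sigma>x admissible_linear[OF s, symmetric] x(2-5) by simp
    then have \<tau>x: "\<tau> x = state10 x (coeff_mu s) (coeff_xi s) (coeff_mu (flip s)) (coeff_xi (flip s)) (dmu s) (dxi s)"
      unfolding \<tau>_def q using x(2-5) eq by simp
    have "x \<in> U" using x eq by (simp add: U_def)
    then show "s \<in> \<tau> ` U" by (rule image_eqI[where x = x, rotated]) (rule trans[OF x(6) \<tau>x[symmetric]])
  qed
  show "dim_at_most TYPE(10) (jet_of ` ?S)" by (rule dim_at_most_chart[OF \<tau> cover])
  show "dim_at_most TYPE(10) (jet_of ` flip ` ?S)"
    by (rule dim_at_most_chart[OF smooth_family_flip[OF \<tau>]]) (use cover in blast)
qed

text \<open>Where the matrix vanishes, four coordinates are lost and both \<open>\<mu>'\<close> and \<open>\<xi>'\<close> may be free, so \<open>6 + 2\<close>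
parameters suffice; the last two coordinates of the chart are ignored.\<close>
lemma dim_zero_rank:
  "dim_at_most TYPE(10) (jet_of `
     {s \<in> admissible. coeff_mu s = 0 \<and> coeff_xi s = 0 \<and> coeff_mu (flip s) = 0 \<and> coeff_xi (flip s) = 0})"
proof (rule dim_at_most_chart)
  show "smooth_family nondeg10 (\<lambda>x. state10 x 0 0 0 0 (x $ 7) (x $ 8))"
    by (rule smooth_state10[OF open_nondeg10]) (auto intro: smooth_on_const smooth_on_nth)
  show "{s \<in> admissible. coeff_mu s = 0 \<and> coeff_xi s = 0 \<and> coeff_mu (flip s) = 0 \<and> coeff_xi (flip s) = 0}
      \<subseteq> (\<lambda>x. state10 x 0 0 0 0 (x $ 7) (x $ 8)) ` nondeg10"
  proof safe
    fix s assume s: "s \<in> admissible" and q: "coeff_mu s = 0" "coeff_xi s = 0" "coeff_mu (flip s) = 0" "coeff_xi (flip s) = 0"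
    have v: "valid s" using s by (simp add: admissible_def)
    obtain x where x: "x \<in> nondeg10" "x $ 7 = dmu s" "x $ 8 = dxi s"
      "s = state10 x (coeff_mu s) (coeff_xi s) (coeff_mu (flip s)) (coeff_xi (flip s)) (dmu s) (dxi s)"
      by (rule state10_surj[OF v, of "dmu s" "dxi s" 0 0]) (rule that; assumption)
    show "s \<in> (\<lambda>x. state10 x 0 0 0 0 (x $ 7) (x $ 8)) ` nondeg10"
      by (rule image_eqI[where x = x, OF _ x(1)]) (use x(2-4) q in simp)
  qed
qed

lemma dim_admissible: "dim_at_most TYPE(10) (jet_of ` admissible)"
proof -
  note Un = dim_at_most_Un[OF dim_regular_rank dim_at_most_Un[OF dim_zero_rank
      dim_at_most_Un[OF dim_at_most_Un[OF dim_first_entry dim_first_entry_flip]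
        dim_at_most_Un[OF dim_second_entry dim_second_entry_flip]]]]
  have fl: "s \<in> flip ` {s \<in> admissible. R s}" if "s \<in> admissible" "R (flip s)" for s R
    using that admissible_flip by (intro image_eqI[of _ _ "flip s"]) auto
  have "jet_of ` admissible \<subseteq> jet_of ` {s \<in> admissible. coeff_mu s * coeff_mu (flip s) \<noteq> coeff_xi s * coeff_xi (flip s)} \<union>
    (jet_of ` {s \<in> admissible. coeff_mu s = 0 \<and> coeff_xi s = 0 \<and> coeff_mu (flip s) = 0 \<and> coeff_xi (flip s) = 0} \<union>
    (jet_of ` {s \<in> admissible. coeff_mu s * coeff_mu (flip s) = coeff_xi s * coeff_xi (flip s) \<and> coeff_mu s \<noteq> 0} \<union>
     jet_of ` flip ` {s \<in> admissible. coeff_mu s * coeff_mu (flip s) = coeff_xi s * coeff_xi (flip s) \<and> coeff_mu s \<noteq> 0} \<union>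
    (jet_of ` {s \<in> admissible. coeff_mu s * coeff_mu (flip s) = coeff_xi s * coeff_xi (flip s) \<and> coeff_xi s \<noteq> 0} \<union>
     jet_of ` flip ` {s \<in> admissible. coeff_mu s * coeff_mu (flip s) = coeff_xi s * coeff_xi (flip s) \<and> coeff_xi s \<noteq> 0})))"
    unfolding image_Un[symmetric]
  proof (rule image_mono, rule subsetI)
    fix s assume s: "s \<in> admissible"
    show "s \<in> {s \<in> admissible. coeff_mu s * coeff_mu (flip s) \<noteq> coeff_xi s * coeff_xi (flip s)} \<union>
    ({s \<in> admissible. coeff_mu s = 0 \<and> coeff_xi s = 0 \<and> coeff_mu (flip s) = 0 \<and> coeff_xi (flip s) = 0} \<union>
    ({s \<in> admissible. coeff_mu s * coeff_mu (flip s) = coeff_xi s * coeff_xi (flip s) \<and> coeff_mu s \<noteq> 0} \<union>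
     flip ` {s \<in> admissible. coeff_mu s * coeff_mu (flip s) = coeff_xi s * coeff_xi (flip s) \<and> coeff_mu s \<noteq> 0} \<union>
    ({s \<in> admissible. coeff_mu s * coeff_mu (flip s) = coeff_xi s * coeff_xi (flip s) \<and> coeff_xi s \<noteq> 0} \<union>
     flip ` {s \<in> admissible. coeff_mu s * coeff_mu (flip s) = coeff_xi s * coeff_xi (flip s) \<and> coeff_xi s \<noteq> 0})))"
      using s fl[of s "\<lambda>s. coeff_mu s * coeff_mu (flip s) = coeff_xi s * coeff_xi (flip s) \<and> coeff_mu s \<noteq> 0"]
        fl[of s "\<lambda>s. coeff_mu s * coeff_mu (flip s) = coeff_xi s * coeff_xi (flip s) \<and> coeff_xi s \<noteq> 0"]
      by (auto simp: mult.commute)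
  qed
  from dim_at_most_mono[OF Un this] show ?thesis .
qed

section \<open>Uniqueness along lines\<close>

text \<open>\<open>E\<close> times a suitable exponential is monotone on either side of the zero \<open>c\<close> and so cannot leave zero.\<close>
lemma gronwall_zero:
  fixes E :: "real \<Rightarrow> real"
  assumes c: "c \<in> {a..b}" "E c = 0"
    and E: "\<And>x. x \<in> {a..b} \<Longrightarrow> (E has_real_derivative E' x) (at x)"
      "\<And>x. x \<in> {a..b} \<Longrightarrow> 0 \<le> E x" "\<And>x. x \<in> {a..b} \<Longrightarrow> \<bar>E' x\<bar> \<le> L * E x"
    and x: "x \<in> {a..b}"
  shows "E x = 0"
proof -
  have D: "((\<lambda>t. E t * exp (r * t)) has_real_derivative (E' t + r * E t) * exp (r * t)) (at t)"
    if "t \<in> {a..b}" for t r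
    using E(1)[OF that] by (auto intro!: derivative_eq_intros simp: algebra_simps)
  have "E x * exp (r * x) \<le> 0" if r: "r = (if c \<le> x then - L else L)" for r
  proof (cases "c \<le> x")
    case True
    have "E x * exp (r * x) \<le> E c * exp (r * c)"
    proof (rule DERIV_nonpos_imp_nonincreasing[OF True])
      fix t assume "c \<le> t" "t \<le> x"
      then have t: "t \<in> {a..b}" using c x by auto
      have "E' t + r * E t \<le> 0" using E(3)[OF t] r True by auto
      then show "\<exists>y. ((\<lambda>t. E t * exp (r * t)) has_real_derivative y) (at t) \<and> y \<le> 0"
        using D[OF t, of r] by (auto intro!: exI mult_nonpos_nonneg)
    qed
    then show ?thesis using c by simp
  next
    case False
    then have "x \<le> c" by simp
    have "E x * exp (r * x) \<le> E c * exp (r * c)"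
    proof (rule DERIV_nonneg_imp_nondecreasing[OF \<open>x \<le> c\<close>])
      fix t assume "x \<le> t" "t \<le> c"
      then have t: "t \<in> {a..b}" using c x by auto
      have "0 \<le> E' t + r * E t" using E(3)[OF t] r False by auto
      then show "\<exists>y. ((\<lambda>t. E t * exp (r * t)) has_real_derivative y) (at t) \<and> 0 \<le> y"
        using D[OF t, of r] by (auto intro!: exI mult_nonneg_nonneg)
    qed
    then show ?thesis using c by simp
  qed
  then have "E x \<le> 0" by (simp add: mult_le_0_iff)
  with E(2)[OF x] show ?thesis by simp
qed

lemma finite_fields [simp]: "finite fields"
  by (simp add: fields_def)

definition sq_dist :: "state \<Rightarrow> state \<Rightarrow> real" where
  "sq_dist s t = (\<Sum>h\<in>fields. (h s - h t)\<^sup>2)"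

lemma sq_dist_nonneg: "0 \<le> sq_dist s t"
  by (simp add: sq_dist_def sum_nonneg)

lemma field_le_sq_dist: "h \<in> fields \<Longrightarrow> \<bar>h s - h t\<bar> \<le> sqrt (sq_dist s t)"
  unfolding sq_dist_def
  by (intro real_le_rsqrt) (simp add: member_le_sum[of h fields "\<lambda>h. (h s - h t)\<^sup>2"])

lemma sq_dist_eq_0: "sq_dist s t = 0 \<Longrightarrow> s = t"
  by (auto simp: sq_dist_def sum_nonneg_eq_0_iff fields_def intro: state.equality)

lemma sq_dist_self [simp]: "sq_dist s s = 0"
  by (simp add: sq_dist_def)

text \<open>Along two families of states over a compact set of parameters, products and inverses preserve Lipschitz
estimates because all factors are bounded there. The continuity statements are carried along to supply these
bounds.\<close>
lemma regular_lipschitz: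
  fixes K :: "'a::topological_space set"
  assumes K: "compact K" and v: "\<And>x. x \<in> K \<Longrightarrow> valid (\<sigma> x) \<and> valid (\<tau> x)"
    and cont: "\<And>h. h \<in> fields \<Longrightarrow> continuous_on K (\<lambda>x. h (\<sigma> x)) \<and> continuous_on K (\<lambda>x. h (\<tau> x))"
    and "regular h"
  shows "continuous_on K (\<lambda>x. h (\<sigma> x)) \<and> continuous_on K (\<lambda>x. h (\<tau> x)) \<and>
    (\<exists>L. \<forall>x\<in>K. \<bar>h (\<sigma> x) - h (\<tau> x)\<bar> \<le> L * sqrt (sq_dist (\<sigma> x) (\<tau> x)))"
  using \<open>regular h\<close>
proof (induction rule: regular.induct)
  case (regular_const c)
  show ?case by (intro conjI exI[of _ 0]) simp_all
next
  case (regular_field h)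
  then show ?case using cont field_le_sq_dist by (intro conjI exI[of _ 1]) auto
next
  case (regular_add h k)
  then obtain L M where L: "\<And>x. x \<in> K \<Longrightarrow> \<bar>h (\<sigma> x) - h (\<tau> x)\<bar> \<le> L * sqrt (sq_dist (\<sigma> x) (\<tau> x))"
    "\<And>x. x \<in> K \<Longrightarrow> \<bar>k (\<sigma> x) - k (\<tau> x)\<bar> \<le> M * sqrt (sq_dist (\<sigma> x) (\<tau> x))" by blast
  have "\<bar>(h (\<sigma> x) + k (\<sigma> x)) - (h (\<tau> x) + k (\<tau> x))\<bar> \<le> (L + M) * sqrt (sq_dist (\<sigma> x) (\<tau> x))" if "x \<in> K" for x
    using L[OF that] unfolding distrib_right by linarith
  then show ?case using regular_add.IH by (auto intro: continuous_on_add)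
next
  case (regular_mult h k)
  then obtain L M where L: "\<And>x. x \<in> K \<Longrightarrow> \<bar>h (\<sigma> x) - h (\<tau> x)\<bar> \<le> L * sqrt (sq_dist (\<sigma> x) (\<tau> x))"
    "\<And>x. x \<in> K \<Longrightarrow> \<bar>k (\<sigma> x) - k (\<tau> x)\<bar> \<le> M * sqrt (sq_dist (\<sigma> x) (\<tau> x))" by blast
  have "bounded ((\<lambda>x. h (\<sigma> x)) ` K)" "bounded ((\<lambda>x. k (\<tau> x)) ` K)"
    using regular_mult.IH K by (auto intro: compact_imp_bounded compact_continuous_image)
  then obtain a b where ab: "\<And>x. x \<in> K \<Longrightarrow> \<bar>h (\<sigma> x)\<bar> \<le> a" "\<And>x. x \<in> K \<Longrightarrow> \<bar>k (\<tau> x)\<bar> \<le> b"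
    by (auto simp: bounded_iff)
  have "\<bar>h (\<sigma> x) * k (\<sigma> x) - h (\<tau> x) * k (\<tau> x)\<bar> \<le> (a * M + b * L) * sqrt (sq_dist (\<sigma> x) (\<tau> x))" if x: "x \<in> K" for x
  proof -
    have "h (\<sigma> x) * k (\<sigma> x) - h (\<tau> x) * k (\<tau> x) =
        h (\<sigma> x) * (k (\<sigma> x) - k (\<tau> x)) + k (\<tau> x) * (h (\<sigma> x) - h (\<tau> x))"
      by (simp add: algebra_simps)
    then have "\<bar>h (\<sigma> x) * k (\<sigma> x) - h (\<tau> x) * k (\<tau> x)\<bar> \<le>
        \<bar>h (\<sigma> x)\<bar> * \<bar>k (\<sigma> x) - k (\<tau> x)\<bar> + \<bar>k (\<tau> x)\<bar> * \<bar>h (\<sigma> x) - h (\<tau> x)\<bar>"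
      by (metis abs_mult abs_triangle_ineq)
    also have "\<dots> \<le> a * (M * sqrt (sq_dist (\<sigma> x) (\<tau> x))) + b * (L * sqrt (sq_dist (\<sigma> x) (\<tau> x)))"
      by (intro add_mono mult_mono' ab L x abs_ge_zero)
    finally show ?thesis by (simp add: algebra_simps)
  qed
  then show ?case using regular_mult.IH by (auto intro: continuous_on_mult)
next
  case (regular_inverse h)
  then have h: "h \<in> fields" and nz: "x \<in> K \<Longrightarrow> h (\<sigma> x) \<noteq> 0 \<and> h (\<tau> x) \<noteq> 0" for x
    using v by (auto simp: fields_def valid_def)
  have c: "continuous_on K (\<lambda>x. inverse (h (\<sigma> x)))" "continuous_on K (\<lambda>x. inverse (h (\<tau> x)))"
    using cont[OF h] nz by (auto intro!: Limits.continuous_on_inverse)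
  then have "bounded ((\<lambda>x. inverse (h (\<sigma> x))) ` K)" "bounded ((\<lambda>x. inverse (h (\<tau> x))) ` K)"
    using K by (auto intro: compact_imp_bounded compact_continuous_image)
  then obtain a b where ab: "\<And>x. x \<in> K \<Longrightarrow> \<bar>inverse (h (\<sigma> x))\<bar> \<le> a" "\<And>x. x \<in> K \<Longrightarrow> \<bar>inverse (h (\<tau> x))\<bar> \<le> b"
    unfolding bounded_iff by (metis image_eqI real_norm_def)
  have "\<bar>inverse (h (\<sigma> x)) - inverse (h (\<tau> x))\<bar> \<le> (a * b) * sqrt (sq_dist (\<sigma> x) (\<tau> x))" if x: "x \<in> K" for x
  proof -
    have "inverse (h (\<sigma> x)) - inverse (h (\<tau> x)) = - (inverse (h (\<sigma> x)) * inverse (h (\<tau> x)) * (h (\<sigma> x) - h (\<tau> x)))"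
      using nz[OF x] by (simp add: field_simps)
    then have "\<bar>inverse (h (\<sigma> x)) - inverse (h (\<tau> x))\<bar> =
        \<bar>inverse (h (\<sigma> x))\<bar> * \<bar>inverse (h (\<tau> x))\<bar> * \<bar>h (\<sigma> x) - h (\<tau> x)\<bar>"
      by (simp add: abs_mult)
    also have "\<dots> \<le> (a * b) * sqrt (sq_dist (\<sigma> x) (\<tau> x))"
      by (intro mult_mono' ab x field_le_sq_dist h abs_ge_zero mult_nonneg_nonneg)
    finally show ?thesis .
  qed
  then have "\<exists>L. \<forall>x\<in>K. \<bar>inverse (h (\<sigma> x)) - inverse (h (\<tau> x))\<bar> \<le> L * sqrt (sq_dist (\<sigma> x) (\<tau> x))"
    by (intro exI[of _ "a * b"] ballI)
  with c show ?case by (intro conjI)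
qed

text \<open>The system of ordinary differential equations that a solution satisfies along the lines of constant \<open>v\<close>,
as pairs of a coordinate and its derivative.\<close>
definition u_rate :: "((state \<Rightarrow> real) \<times> (state \<Rightarrow> real)) set" where
  "u_rate = {(f0, Fu), (f1, \<lambda>s. - P s * A s), (g0, Gu), (g1, \<lambda>s. g1 s * B s), (al, d_al), (ka, d_ka),
    (mu, dmu), (be, \<lambda>s. 0), (et, \<lambda>s. 0), (xi, \<lambda>s. 0), (dmu, d2_mu), (dxi, \<lambda>s. 0)}"

lemma u_rate_regular: "(h, k) \<in> u_rate \<Longrightarrow> regular k"
  by (auto simp: u_rate_def intro!: regular_second regular_d2_mu)

lemma u_rate_fields: "h \<in> fields \<Longrightarrow> \<exists>k. (h, k) \<in> u_rate"
  unfolding fields_def u_rate_def by (elim insertE emptyE; simp add: ex_disj_distrib)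

text \<open>Uniqueness for ordinary differential equations: the squared distance of the two curves satisfies
\<open>\<bar>E'\<bar> \<le> L E\<close>.\<close>
lemma u_rate_unique:
  fixes \<sigma> \<tau> :: "real \<Rightarrow> state"
  assumes c: "c \<in> {a..b}" "\<sigma> c = \<tau> c" and v: "\<And>x. x \<in> {a..b} \<Longrightarrow> valid (\<sigma> x) \<and> valid (\<tau> x)"
    and D: "\<And>h k x. (h, k) \<in> u_rate \<Longrightarrow> x \<in> {a..b} \<Longrightarrow>
      ((\<lambda>x. h (\<sigma> x)) has_real_derivative k (\<sigma> x)) (at x) \<and>
      ((\<lambda>x. h (\<tau> x)) has_real_derivative k (\<tau> x)) (at x)"
    and x: "x \<in> {a..b}"
  shows "\<sigma> x = \<tau> x"
proof -
  have "\<forall>h\<in>fields. \<exists>k. (h, k) \<in> u_rate" using u_rate_fields by (intro ballI)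
  from bchoice[OF this] obtain r where "\<forall>h\<in>fields. (h, r h) \<in> u_rate" ..
  then have r: "(h, r h) \<in> u_rate" if "h \<in> fields" for h using that by (rule bspec)
  have cont: "continuous_on {a..b} (\<lambda>x. h (\<sigma> x)) \<and> continuous_on {a..b} (\<lambda>x. h (\<tau> x))" if "h \<in> fields" for h
    using DERIV_continuous_on[OF has_field_derivative_at_within[OF conjunct1[OF D[OF r[OF that]]]]]
      DERIV_continuous_on[OF has_field_derivative_at_within[OF conjunct2[OF D[OF r[OF that]]]]]
    by (intro conjI)
  have "\<exists>L. \<forall>x\<in>{a..b}. \<bar>r h (\<sigma> x) - r h (\<tau> x)\<bar> \<le> L * sqrt (sq_dist (\<sigma> x) (\<tau> x))" if "h \<in> fields" for h
    using regular_lipschitz[OF compact_Icc v cont u_rate_regular[OF r[OF that]]] by blast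
  then have "\<forall>h\<in>fields. \<exists>L. \<forall>x\<in>{a..b}. \<bar>r h (\<sigma> x) - r h (\<tau> x)\<bar> \<le> L * sqrt (sq_dist (\<sigma> x) (\<tau> x))"
    by (intro ballI)
  from bchoice[OF this] obtain L where
    "\<forall>h\<in>fields. \<forall>x\<in>{a..b}. \<bar>r h (\<sigma> x) - r h (\<tau> x)\<bar> \<le> L h * sqrt (sq_dist (\<sigma> x) (\<tau> x))" ..
  then have L: "\<bar>r h (\<sigma> x) - r h (\<tau> x)\<bar> \<le> L h * sqrt (sq_dist (\<sigma> x) (\<tau> x))"
    if "h \<in> fields" "x \<in> {a..b}" for h x using that by simp
  let ?E = "\<lambda>x. sq_dist (\<sigma> x) (\<tau> x)"
  have "?E x = 0"
  proof (rule gronwall_zero[where E = ?E and c = c and a = a and b = b and L = "2 * sum L fields"])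
    show "c \<in> {a..b}" "x \<in> {a..b}" "sq_dist (\<sigma> c) (\<tau> c) = 0" using c x by simp_all
    fix y assume y: "y \<in> {a..b}"
    show "0 \<le> ?E y" by (rule sq_dist_nonneg)
    show "(?E has_real_derivative (\<Sum>h\<in>fields. 2 * (h (\<sigma> y) - h (\<tau> y)) * (r h (\<sigma> y) - r h (\<tau> y)))) (at y)"
      unfolding sq_dist_def
    proof (rule DERIV_sum)
      fix h :: "state \<Rightarrow> real" assume "h \<in> fields"
      from D[OF r[OF this] y] show "((\<lambda>x. (h (\<sigma> x) - h (\<tau> x))\<^sup>2) has_real_derivative
          2 * (h (\<sigma> y) - h (\<tau> y)) * (r h (\<sigma> y) - r h (\<tau> y))) (at y)"
        by (auto intro!: derivative_eq_intros)
    qed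
    have "\<bar>2 * (h (\<sigma> y) - h (\<tau> y)) * (r h (\<sigma> y) - r h (\<tau> y))\<bar> \<le> 2 * L h * ?E y" if h: "h \<in> fields" for h
    proof -
      have "\<bar>h (\<sigma> y) - h (\<tau> y)\<bar> * \<bar>r h (\<sigma> y) - r h (\<tau> y)\<bar> \<le>
          sqrt (?E y) * (L h * sqrt (?E y))"
        by (intro mult_mono' field_le_sq_dist L h y abs_ge_zero)
      also have "\<dots> = L h * (sqrt (?E y) * sqrt (?E y))" by (simp only: mult_ac)
      also have "\<dots> = L h * ?E y" by (simp add: sq_dist_nonneg)
      finally show ?thesis unfolding abs_mult abs_numeral by linarith
    qed
    then have "\<bar>\<Sum>h\<in>fields. 2 * (h (\<sigma> y) - h (\<tau> y)) * (r h (\<sigma> y) - r h (\<tau> y))\<bar> \<le> (\<Sum>h\<in>fields. 2 * L h * ?E y)"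
      by (intro order_trans[OF sum_abs] sum_mono)
    then show "\<bar>\<Sum>h\<in>fields. 2 * (h (\<sigma> y) - h (\<tau> y)) * (r h (\<sigma> y) - r h (\<tau> y))\<bar> \<le> 2 * sum L fields * ?E y"
      by (simp add: sum_distrib_left sum_distrib_right)
  qed
  then show ?thesis by (rule sq_dist_eq_0)
qed

section \<open>The state of a solution\<close>

definition sol_on :: "real set \<Rightarrow> real set \<Rightarrow> unknowns \<Rightarrow> bool" where
  "sol_on I J s \<longleftrightarrow> open I \<and> open J \<and>
     (\<forall>f\<in>{F0 s, F1 s, G0 s, G1 s}. smooth_on (I \<times> J) (\<lambda>(u, v). f u v)) \<and>
     (\<forall>f\<in>{\<alpha> s, \<kappa> s, \<mu> s}. smooth_on I f) \<and>
     (\<forall>f\<in>{\<beta> s, \<eta> s, \<xi> s}. smooth_on J f) \<and>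
     (\<forall>u\<in>I. \<forall>v\<in>J. nondegenerate s u v \<and> satisfies_system s u v \<and> F0 s u v \<noteq> 0 \<and> G0 s u v \<noteq> 0)"

definition state_at :: "unknowns \<Rightarrow> real \<Rightarrow> real \<Rightarrow> state" where
  "state_at s u v = \<lparr>f0 = F0 s u v, f1 = F1 s u v, g0 = G0 s u v, g1 = G1 s u v,
     al = \<alpha> s u, ka = \<kappa> s u, mu = \<mu> s u, be = \<beta> s v, et = \<eta> s v, xi = \<xi> s v,
     dmu = deriv (\<mu> s) u, dxi = deriv (\<xi> s) v\<rparr>"

lemma state_at_simps [simp]:
  "f0 (state_at s u v) = F0 s u v" "f1 (state_at s u v) = F1 s u v"
  "g0 (state_at s u v) = G0 s u v" "g1 (state_at s u v) = G1 s u v"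
  "al (state_at s u v) = \<alpha> s u" "ka (state_at s u v) = \<kappa> s u" "mu (state_at s u v) = \<mu> s u"
  "be (state_at s u v) = \<beta> s v" "et (state_at s u v) = \<eta> s v" "xi (state_at s u v) = \<xi> s v"
  "dmu (state_at s u v) = deriv (\<mu> s) u" "dxi (state_at s u v) = deriv (\<xi> s) v"
  by (simp_all add: state_at_def)

definition flip_unknowns :: "unknowns \<Rightarrow> unknowns" where
  "flip_unknowns s = \<lparr>F0 = \<lambda>v u. G0 s u v, F1 = \<lambda>v u. G1 s u v, G0 = \<lambda>v u. F0 s u v, G1 = \<lambda>v u. F1 s u v,
     \<alpha> = \<beta> s, \<kappa> = \<eta> s, \<mu> = \<xi> s, \<beta> = \<alpha> s, \<eta> = \<kappa> s, \<xi> = \<mu> s\<rparr>"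

lemma flip_unknowns_simps [simp]:
  "F0 (flip_unknowns s) = (\<lambda>v u. G0 s u v)" "F1 (flip_unknowns s) = (\<lambda>v u. G1 s u v)"
  "G0 (flip_unknowns s) = (\<lambda>v u. F0 s u v)" "G1 (flip_unknowns s) = (\<lambda>v u. F1 s u v)"
  "\<alpha> (flip_unknowns s) = \<beta> s" "\<kappa> (flip_unknowns s) = \<eta> s" "\<mu> (flip_unknowns s) = \<xi> s"
  "\<beta> (flip_unknowns s) = \<alpha> s" "\<eta> (flip_unknowns s) = \<kappa> s" "\<xi> (flip_unknowns s) = \<mu> s"
  by (simp_all add: flip_unknowns_def)

lemma state_at_flip: "state_at (flip_unknowns s) v u = flip (state_at s u v)"
  by (simp add: state_at_def flip_def)

lemma sol_on_flip:
  assumes "sol_on I J s"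
  shows "sol_on J I (flip_unknowns s)"
proof -
  have "nondegenerate (flip_unknowns s) v u \<and> satisfies_system (flip_unknowns s) v u"
    if "nondegenerate s u v" "satisfies_system s u v" for u v
    using that unfolding nondegenerate_def satisfies_system_def pdu_def pdv_def
    by (simp add: mult.commute)
  with assms show ?thesis
    by (auto simp: sol_on_def intro!: smooth_on_swap)
qed

context
  fixes I J s
  assumes sol: "sol_on I J s"
begin

lemma openI: "open I" and openJ: "open J"
  using sol by (auto simp: sol_on_def)

lemma smooth_F0: "smooth_on (I \<times> J) (\<lambda>(u, v). F0 s u v)"
  and smooth_F1: "smooth_on (I \<times> J) (\<lambda>(u, v). F1 s u v)"
  and smooth_G0: "smooth_on (I \<times> J) (\<lambda>(u, v). G0 s u v)"
  and smooth_G1: "smooth_on (I \<times> J) (\<lambda>(u, v). G1 s u v)"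
  and smooth_u: "smooth_on I (\<alpha> s)" "smooth_on I (\<kappa> s)" "smooth_on I (\<mu> s)"
  and smooth_v: "smooth_on J (\<beta> s)" "smooth_on J (\<eta> s)" "smooth_on J (\<xi> s)"
  using sol by (auto simp: sol_on_def)

lemma valid_state: "u \<in> I \<Longrightarrow> v \<in> J \<Longrightarrow> valid (state_at s u v)"
  using sol by (auto simp: sol_on_def nondegenerate_def valid_def P_def)

text \<open>Since \<open>G0 \<noteq> 0\<close>, the equations of the system can be solved for the first derivatives of \<open>F0\<close> and \<open>F1\<close>.\<close>
lemma partials_F:
  assumes "u \<in> I" "v \<in> J"
  shows "pdv (F0 s) u v = Fv (state_at s u v)" "pdu (F0 s) u v = Fu (state_at s u v)"
    "pdv (F1 s) u v = F1 s u v * A (state_at s u v)"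
    "pdu (F1 s) u v = - P (state_at s u v) * A (state_at s u v)"
proof -
  have sys: "satisfies_system s u v" and nz: "G0 s u v \<noteq> 0"
    using sol assms by (auto simp: sol_on_def)
  note sys = sys[unfolded satisfies_system_def]
  show 1: "pdv (F0 s) u v = Fv (state_at s u v)" using sys nz by (simp add: Fv_def field_simps)
  show 2: "pdv (F1 s) u v = F1 s u v * A (state_at s u v)" using sys nz by (simp add: A_def field_simps)
  show "pdu (F0 s) u v = Fu (state_at s u v)" using sys by (simp add: Fu_def P_def 1[symmetric])
  show "pdu (F1 s) u v = - P (state_at s u v) * A (state_at s u v)"
    using sys 2 by (simp add: P_def algebra_simps)
qed

end

lemma partials_G:
  assumes sol: "sol_on I J s" and uv: "u \<in> I" "v \<in> J"
  shows "pdu (G0 s) u v = Gu (state_at s u v)" "pdv (G0 s) u v = Gv (state_at s u v)"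
    "pdu (G1 s) u v = G1 s u v * B (state_at s u v)"
    "pdv (G1 s) u v = - P (state_at s u v) * B (state_at s u v)"
  using partials_F[OF sol_on_flip[OF sol] uv(2,1)]
  by (simp_all add: state_at_flip pdu_def pdv_def)

context
  fixes I J s
  assumes sol: "sol_on I J s"
begin

lemma DERIV_u:
  assumes "u \<in> I" "v \<in> J"
  shows "((\<lambda>u. F0 s u v) has_real_derivative Fu (state_at s u v)) (at u)"
    "((\<lambda>u. F1 s u v) has_real_derivative - P (state_at s u v) * A (state_at s u v)) (at u)"
    "((\<lambda>u. G0 s u v) has_real_derivative Gu (state_at s u v)) (at u)"
    "((\<lambda>u. G1 s u v) has_real_derivative G1 s u v * B (state_at s u v)) (at u)"
    "(\<alpha> s has_real_derivative deriv (\<alpha> s) u) (at u)"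
    "(\<kappa> s has_real_derivative deriv (\<kappa> s) u) (at u)"
    "(\<mu> s has_real_derivative deriv (\<mu> s) u) (at u)"
    "(deriv (\<alpha> s) has_real_derivative deriv (deriv (\<alpha> s)) u) (at u)"
    "(deriv (\<mu> s) has_real_derivative deriv (deriv (\<mu> s)) u) (at u)"
  using smooth_on_pdu(1)[OF openI[OF sol] openJ[OF sol] smooth_F0[OF sol] assms]
    smooth_on_pdu(1)[OF openI[OF sol] openJ[OF sol] smooth_F1[OF sol] assms]
    smooth_on_pdu(1)[OF openI[OF sol] openJ[OF sol] smooth_G0[OF sol] assms]
    smooth_on_pdu(1)[OF openI[OF sol] openJ[OF sol] smooth_G1[OF sol] assms]
    smooth_on_deriv[OF openI[OF sol] smooth_u(1)[OF sol]] smooth_on_deriv[OF openI[OF sol] smooth_u(2)[OF sol]]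
    smooth_on_deriv[OF openI[OF sol] smooth_u(3)[OF sol]]
    smooth_on_deriv(1)[OF openI[OF sol] smooth_on_deriv(2)[OF openI[OF sol] smooth_u(1)[OF sol]]]
    smooth_on_deriv(1)[OF openI[OF sol] smooth_on_deriv(2)[OF openI[OF sol] smooth_u(3)[OF sol]]]
    assms
  unfolding partials_F[OF sol assms] partials_G[OF sol assms] by blast+

lemma DERIV_v:
  assumes "u \<in> I" "v \<in> J"
  shows "((\<lambda>v. F0 s u v) has_real_derivative Fv (state_at s u v)) (at v)"
    "((\<lambda>v. F1 s u v) has_real_derivative F1 s u v * A (state_at s u v)) (at v)"
    "((\<lambda>v. G0 s u v) has_real_derivative Gv (state_at s u v)) (at v)"
    "((\<lambda>v. G1 s u v) has_real_derivative - P (state_at s u v) * B (state_at s u v)) (at v)"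
    "(\<beta> s has_real_derivative deriv (\<beta> s) v) (at v)"
    "(\<eta> s has_real_derivative deriv (\<eta> s) v) (at v)"
    "(\<xi> s has_real_derivative deriv (\<xi> s) v) (at v)"
  using smooth_on_pdv(1)[OF openI[OF sol] openJ[OF sol] smooth_F0[OF sol] assms]
    smooth_on_pdv(1)[OF openI[OF sol] openJ[OF sol] smooth_F1[OF sol] assms]
    smooth_on_pdv(1)[OF openI[OF sol] openJ[OF sol] smooth_G0[OF sol] assms]
    smooth_on_pdv(1)[OF openI[OF sol] openJ[OF sol] smooth_G1[OF sol] assms]
    smooth_on_deriv(1)[OF openJ[OF sol] smooth_v(1)[OF sol]] smooth_on_deriv(1)[OF openJ[OF sol] smooth_v(2)[OF sol]]
    smooth_on_deriv(1)[OF openJ[OF sol] smooth_v(3)[OF sol]] assms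
  unfolding partials_F[OF sol assms] partials_G[OF sol assms] by blast+

lemma nonzero:
  assumes "u \<in> I" "v \<in> J"
  shows "F0 s u v \<noteq> 0" "G0 s u v \<noteq> 0" "F1 s u v \<noteq> 0" "G1 s u v \<noteq> 0"
  using valid_state[OF sol assms] by (auto simp: valid_def)

lemma DERIV_A_u:
  assumes "u \<in> I" "v \<in> J"
  shows "((\<lambda>u. A (state_at s u v)) has_real_derivative
    (deriv (\<alpha> s) u - A (state_at s u v) * Gu (state_at s u v)) / G0 s u v) (at u)"
  unfolding A_def
  by (auto intro!: derivative_eq_intros DERIV_u[OF assms] simp: nonzero[OF assms])
    (simp add: nonzero[OF assms] field_simps)

lemma DERIV_A_v:
  assumes "u \<in> I" "v \<in> J"
  shows "((\<lambda>v. A (state_at s u v)) has_real_derivative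
    - (deriv (\<eta> s) v + A (state_at s u v) * Gv (state_at s u v)) / G0 s u v) (at v)"
  unfolding A_def
  by (auto intro!: derivative_eq_intros DERIV_v[OF assms] simp: nonzero[OF assms])
    (simp add: nonzero[OF assms] field_simps)

lemma DERIV_P_v:
  assumes "u \<in> I" "v \<in> J"
  shows "((\<lambda>v. P (state_at s u v)) has_real_derivative
    P (state_at s u v) * (A (state_at s u v) - F1 s u v * B (state_at s u v))) (at v)"
  unfolding P_def
  by (auto intro!: derivative_eq_intros DERIV_v[OF assms] simp: P_def algebra_simps)

lemma DERIV_P_u:
  assumes "u \<in> I" "v \<in> J"
  shows "((\<lambda>u. P (state_at s u v)) has_real_derivative P_u (state_at s u v)) (at u)"
  unfolding P_def P_u_def
  by (auto intro!: derivative_eq_intros DERIV_u[OF assms] simp: P_def algebra_simps)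

lemma DERIV_Fv_u:
  assumes "u \<in> I" "v \<in> J"
  shows "((\<lambda>u. Fv (state_at s u v)) has_real_derivative
    (deriv (\<mu> s) u + deriv (\<alpha> s) u * F0 s u v + \<alpha> s u * Fu (state_at s u v)
     - \<beta> s v * Gu (state_at s u v) * F1 s u v
     + (\<xi> s v + \<beta> s v * G0 s u v) * P (state_at s u v) * A (state_at s u v)
     - Fv (state_at s u v) * Gu (state_at s u v)) / G0 s u v) (at u)"
  unfolding Fv_def[of "state_at s _ v"]
  by (auto intro!: derivative_eq_intros DERIV_u[OF assms] simp: nonzero[OF assms])
    (simp add: nonzero[OF assms] field_simps)

lemma DERIV_Fv_v:
  assumes "u \<in> I" "v \<in> J"
  shows "((\<lambda>v. Fv (state_at s u v)) has_real_derivative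
    (\<alpha> s u * Fv (state_at s u v)
     - (deriv (\<xi> s) v + deriv (\<beta> s) v * G0 s u v + \<beta> s v * Gv (state_at s u v)) * F1 s u v
     - (\<xi> s v + \<beta> s v * G0 s u v) * F1 s u v * A (state_at s u v)
     - Fv (state_at s u v) * Gv (state_at s u v)) / G0 s u v) (at v)"
  unfolding Fv_def[of "state_at s u _"]
  by (auto intro!: derivative_eq_intros DERIV_v[OF assms] simp: nonzero[OF assms])
    (simp add: nonzero[OF assms] Fv_def field_simps)

text \<open>The form in which equality of mixed partials is used: the first derivatives of \<open>f\<close> are known as functions
of the state, and these functions are differentiated once more.\<close>
lemma mixed_derivatives:
  assumes uv: "u \<in> I" "v \<in> J" and f: "smooth_on (I \<times> J) (\<lambda>(u, v). f u v)"
    and eq: "\<And>u v. u \<in> I \<Longrightarrow> v \<in> J \<Longrightarrow> pdu f u v = fu u v" "\<And>u v. u \<in> I \<Longrightarrow> v \<in> J \<Longrightarrow> pdv f u v = fv u v"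
    and D: "((\<lambda>u. fv u v) has_real_derivative x) (at u)" "((\<lambda>v. fu u v) has_real_derivative y) (at v)"
  shows "x = y"
proof -
  note o = openI[OF sol] openJ[OF sol]
  have "((\<lambda>u. fv u v) has_real_derivative pdu (pdv f) u v) (at u)"
    by (rule has_field_derivative_transform_within_open[OF smooth_on_pdu(1)[OF o smooth_on_pdv(2)[OF o f] uv] o(1) uv(1)])
      (simp add: eq uv)
  with D(1) have "x = pdu (pdv f) u v" by (rule DERIV_unique)
  moreover have "((\<lambda>v. fu u v) has_real_derivative pdv (pdu f) u v) (at v)"
    by (rule has_field_derivative_transform_within_open[OF smooth_on_pdv(1)[OF o smooth_on_pdu(2)[OF o f] uv] o(2) uv(2)])
      (simp add: eq uv)
  with D(2) have "y = pdv (pdu f) u v" by (rule DERIV_unique)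
  ultimately show ?thesis using mixed_partials_eq[OF o uv f] by simp
qed

text \<open>Equality of the mixed partials of \<open>F1\<close>, whose first derivatives are \<open>F1 A\<close> and \<open>- P A\<close>.\<close>
lemma compat_F1:
  assumes uv: "u \<in> I" "v \<in> J"
  shows "deriv (\<alpha> s) u - G1 s u v * deriv (\<eta> s) v = S1 (state_at s u v)"
proof -
  let ?s = "state_at s u v"
  define a where "a = (deriv (\<alpha> s) u - A ?s * Gu ?s) / G0 s u v"
  define b where "b = - (deriv (\<eta> s) v + A ?s * Gv ?s) / G0 s u v"
  have ab: "G0 s u v * a = deriv (\<alpha> s) u - A ?s * Gu ?s" "G0 s u v * b = - (deriv (\<eta> s) v + A ?s * Gv ?s)"
    using nonzero[OF uv] by (simp_all add: a_def b_def)
  have "- P ?s * A ?s * A ?s + a * F1 s u v =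
      - (P ?s * (A ?s - F1 s u v * B ?s) * A ?s + b * P ?s)"
  proof (rule mixed_derivatives[OF uv smooth_F1[OF sol] partials_F(4)[OF sol] partials_F(3)[OF sol]])
    show "((\<lambda>u. F1 s u v * A (state_at s u v)) has_real_derivative - P ?s * A ?s * A ?s + a * F1 s u v) (at u)"
      unfolding a_def by (rule DERIV_mult[OF DERIV_u(2)[OF uv] DERIV_A_u[OF uv]])
    show "((\<lambda>v. - P (state_at s u v) * A (state_at s u v)) has_real_derivative
        - (P ?s * (A ?s - F1 s u v * B ?s) * A ?s + b * P ?s)) (at v)"
      using DERIV_minus[OF DERIV_mult[OF DERIV_P_v[OF uv] DERIV_A_v[OF uv]]] by (simp add: b_def)
  qed
  then have "F1 s u v * (a + G1 s u v * b) = F1 s u v * (P ?s * A ?s * B ?s)"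
    by (simp add: P_def algebra_simps)
  then have "a + G1 s u v * b = P ?s * A ?s * B ?s" using nonzero[OF uv] by simp
  moreover have "G0 s u v * a + G1 s u v * (G0 s u v * b) = G0 s u v * (a + G1 s u v * b)"
    by (simp add: algebra_simps)
  ultimately have "G0 s u v * a + G1 s u v * (G0 s u v * b) = G0 s u v * (P ?s * A ?s * B ?s)"
    by simp
  then show ?thesis unfolding ab S1_def by (simp add: algebra_simps)
qed

text \<open>Equality of the mixed partials of \<open>F0\<close>. The terms with \<open>\<beta>'\<close> cancel: in
\<open>F0,u = \<kappa> - P \<beta> - G1 F0,v\<close> the last summand contributes \<open>+ P \<beta>\<close>.\<close>
lemma compat_F0:
  assumes uv: "u \<in> I" "v \<in> J"
  shows "deriv (\<mu> s) u + F0 s u v * deriv (\<alpha> s) u - P (state_at s u v) * deriv (\<xi> s) v = S3 (state_at s u v)"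
proof -
  let ?s = "state_at s u v"
  have *: "\<exists>a. (f has_real_derivative a) F \<and> c * a = x" if "(f has_real_derivative x / c) F" "c \<noteq> 0"
    for f F and c x :: real using that by (intro exI[of _ "x / c"]) simp
  obtain a b where a: "((\<lambda>u. Fv (state_at s u v)) has_real_derivative a) (at u)"
    and b: "((\<lambda>v. Fv (state_at s u v)) has_real_derivative b) (at v)"
    and ab: "G0 s u v * a = deriv (\<mu> s) u + deriv (\<alpha> s) u * F0 s u v + \<alpha> s u * Fu ?s
       - \<beta> s v * Gu ?s * F1 s u v + (\<xi> s v + \<beta> s v * G0 s u v) * P ?s * A ?s - Fv ?s * Gu ?s"
     "G0 s u v * b = \<alpha> s u * Fv ?s - (deriv (\<xi> s) v + deriv (\<beta> s) v * G0 s u v + \<beta> s v * Gv ?s) * F1 s u v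
       - (\<xi> s v + \<beta> s v * G0 s u v) * F1 s u v * A ?s - Fv ?s * Gv ?s"
    using *[OF DERIV_Fv_u[OF uv] nonzero(2)[OF uv]] *[OF DERIV_Fv_v[OF uv] nonzero(2)[OF uv]] by blast
  have "a = - (P ?s * (A ?s - F1 s u v * B ?s) * \<beta> s v + P ?s * deriv (\<beta> s) v)
      + P ?s * B ?s * Fv ?s - G1 s u v * b"
  proof (rule mixed_derivatives[OF uv smooth_F0[OF sol] partials_F(2)[OF sol] partials_F(1)[OF sol] a])
    show "((\<lambda>v. Fu (state_at s u v)) has_real_derivative
        - (P ?s * (A ?s - F1 s u v * B ?s) * \<beta> s v + P ?s * deriv (\<beta> s) v)
        + P ?s * B ?s * Fv ?s - G1 s u v * b) (at v)"
      unfolding Fu_def state_at_simps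
      by (auto intro!: derivative_eq_intros DERIV_v[OF uv] DERIV_P_v[OF uv] b simp: algebra_simps)
  qed
  then have "a + G1 s u v * b = - (P ?s * (A ?s - F1 s u v * B ?s) * \<beta> s v + P ?s * deriv (\<beta> s) v)
      + P ?s * B ?s * Fv ?s" by simp
  moreover have "G0 s u v * a + G1 s u v * (G0 s u v * b) = G0 s u v * (a + G1 s u v * b)"
    by (simp add: algebra_simps)
  ultimately have "G0 s u v * a + G1 s u v * (G0 s u v * b) =
      G0 s u v * (- (P ?s * (A ?s - F1 s u v * B ?s) * \<beta> s v + P ?s * deriv (\<beta> s) v) + P ?s * B ?s * Fv ?s)"
    by simp
  then show ?thesis unfolding ab S3_def by (simp add: P_def algebra_simps)
qed

lemma deriv_alpha:
  assumes uv: "u \<in> I" "v \<in> J"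
  shows "deriv (\<alpha> s) u = d_al (state_at s u v)"
  using compat_F0[OF uv] nonzero[OF uv] by (simp add: d_al_def field_simps)

lemma deriv_eta:
  assumes uv: "u \<in> I" "v \<in> J"
  shows "deriv (\<eta> s) v = d_et (state_at s u v)"
  using compat_F1[OF uv] nonzero[OF uv] by (simp add: d_et_def deriv_alpha[OF uv] field_simps)

end

lemma
  assumes sol: "sol_on I J s" and uv: "u \<in> I" "v \<in> J"
  shows deriv_beta: "deriv (\<beta> s) v = d_be (state_at s u v)"
    and deriv_kappa: "deriv (\<kappa> s) u = d_ka (state_at s u v)"
  using deriv_alpha[OF sol_on_flip[OF sol] uv(2,1)] deriv_eta[OF sol_on_flip[OF sol] uv(2,1)]
  by (simp_all add: state_at_flip d_be_def d_ka_def)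

lemma compat_G0:
  assumes sol: "sol_on I J s" and uv: "u \<in> I" "v \<in> J"
  shows "deriv (\<xi> s) v + G0 s u v * deriv (\<beta> s) v - P (state_at s u v) * deriv (\<mu> s) u = S4 (state_at s u v)"
  using compat_F0[OF sol_on_flip[OF sol] uv(2,1)] by (simp add: state_at_flip S4_def)

context
  fixes I J s
  assumes sol: "sol_on I J s"
begin

lemma DERIV_B_u:
  assumes uv: "u \<in> I" "v \<in> J"
  shows "((\<lambda>u. B (state_at s u v)) has_real_derivative B_u (state_at s u v)) (at u)"
  using DERIV_A_v[OF sol_on_flip[OF sol] uv(2,1)]
  by (simp add: state_at_flip B_u_def deriv_kappa[OF sol uv])

lemma DERIV_first_u:
  assumes uv: "u \<in> I" "v \<in> J"
  shows "((\<lambda>u. A (state_at s u v)) has_real_derivative A_u (state_at s u v)) (at u)"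
    "((\<lambda>u. Fv (state_at s u v)) has_real_derivative Fv_u (state_at s u v)) (at u)"
    "((\<lambda>u. Gu (state_at s u v)) has_real_derivative Gu_u (state_at s u v)) (at u)"
proof -
  show "((\<lambda>u. A (state_at s u v)) has_real_derivative A_u (state_at s u v)) (at u)"
    using DERIV_A_u[OF sol uv] by (simp add: A_u_def deriv_alpha[OF sol uv])
  show "((\<lambda>u. Fv (state_at s u v)) has_real_derivative Fv_u (state_at s u v)) (at u)"
    using DERIV_Fv_u[OF sol uv] by (simp add: Fv_u_def M_u_def deriv_alpha[OF sol uv])
  show "((\<lambda>u. Gu (state_at s u v)) has_real_derivative Gu_u (state_at s u v)) (at u)"
    using DERIV_Fv_v[OF sol_on_flip[OF sol] uv(2,1)]
    by (simp add: state_at_flip Gu_u_def M_u_def deriv_alpha[OF sol uv])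
qed

lemma DERIV_Fu_Gv_u:
  assumes uv: "u \<in> I" "v \<in> J"
  shows "((\<lambda>u. Fu (state_at s u v)) has_real_derivative Fu_u (state_at s u v)) (at u)"
    "((\<lambda>u. Gv (state_at s u v)) has_real_derivative Gv_u (state_at s u v)) (at u)"
proof -
  note D = DERIV_u[OF sol uv] DERIV_P_u[OF sol uv] DERIV_first_u[OF uv]
  show "((\<lambda>u. Fu (state_at s u v)) has_real_derivative Fu_u (state_at s u v)) (at u)"
    unfolding Fu_def state_at_simps Fu_u_def deriv_kappa[OF sol uv, symmetric]
    by (auto intro!: derivative_eq_intros D simp: algebra_simps)
  show "((\<lambda>u. Gv (state_at s u v)) has_real_derivative Gv_u (state_at s u v)) (at u)"
    unfolding Gv_def Fu_def flip_simps flip_derived state_at_simps Gv_u_def deriv_alpha[OF sol uv, symmetric]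
    by (auto intro!: derivative_eq_intros D simp: algebra_simps)
qed

lemma DERIV_S_u:
  assumes uv: "u \<in> I" "v \<in> J"
  shows "((\<lambda>u. S1 (state_at s u v)) has_real_derivative S1_u (state_at s u v)) (at u)"
    "((\<lambda>u. S3 (state_at s u v)) has_real_derivative S3_u (state_at s u v)) (at u)"
    "((\<lambda>u. S4 (state_at s u v)) has_real_derivative S4_u (state_at s u v)) (at u)"
proof -
  note D = DERIV_u[OF sol uv] DERIV_P_u[OF sol uv] DERIV_first_u[OF uv] DERIV_B_u[OF uv] DERIV_Fu_Gv_u[OF uv]
  show "((\<lambda>u. S1 (state_at s u v)) has_real_derivative S1_u (state_at s u v)) (at u)"
    unfolding S1_def state_at_simps S1_u_def
    by (auto intro!: derivative_eq_intros D simp: algebra_simps)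
  show "((\<lambda>u. S3 (state_at s u v)) has_real_derivative S3_u (state_at s u v)) (at u)"
    unfolding S3_def state_at_simps S3_u_def deriv_alpha[OF sol uv, symmetric]
    by (auto intro!: derivative_eq_intros D simp: algebra_simps)
  show "((\<lambda>u. S4 (state_at s u v)) has_real_derivative S4_u (state_at s u v)) (at u)"
    unfolding S4_def S3_def flip_simps flip_derived state_at_simps S4_u_def deriv_alpha[OF sol uv, symmetric]
    by (auto intro!: derivative_eq_intros D simp: algebra_simps)
qed

end

context
  fixes I J s
  assumes sol: "sol_on I J s"
begin

lemma DERIV_eq_on:
  assumes "u \<in> I" "\<And>x. x \<in> I \<Longrightarrow> f x = g x"
    "(f has_real_derivative x) (at u)" "(g has_real_derivative y) (at u)"
  shows "x = y"
  using has_field_derivative_transform_within_open[OF assms(3) openI[OF sol] assms(1,2)] assms(4)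
  by (rule DERIV_unique)

lemma deriv2_alpha:
  assumes uv: "u \<in> I" "v \<in> J"
  shows "deriv (deriv (\<alpha> s)) u = d2_al (state_at s u v)"
proof -
  let ?s = "state_at s u v"
  have "deriv (deriv (\<alpha> s)) u - G1 s u v * B ?s * deriv (\<eta> s) v = S1_u ?s"
  proof (rule DERIV_eq_on[OF uv(1) _ _ DERIV_S_u(1)[OF sol uv]])
    show "((\<lambda>u. deriv (\<alpha> s) u - G1 s u v * deriv (\<eta> s) v) has_real_derivative
        deriv (deriv (\<alpha> s)) u - G1 s u v * B ?s * deriv (\<eta> s) v) (at u)"
      by (auto intro!: derivative_eq_intros DERIV_u[OF sol uv])
  qed (rule compat_F1[OF sol _ uv(2)])
  then show ?thesis by (simp add: d2_al_def deriv_eta[OF sol uv])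
qed

lemma deriv2_mu:
  assumes uv: "u \<in> I" "v \<in> J"
  shows "deriv (deriv (\<mu> s)) u = d2_mu (state_at s u v)"
proof -
  let ?s = "state_at s u v"
  have "deriv (deriv (\<mu> s)) u + (Fu ?s * deriv (\<alpha> s) u + F0 s u v * deriv (deriv (\<alpha> s)) u)
      - P_u ?s * deriv (\<xi> s) v = S3_u ?s"
  proof (rule DERIV_eq_on[OF uv(1) _ _ DERIV_S_u(2)[OF sol uv]])
    show "((\<lambda>u. deriv (\<mu> s) u + F0 s u v * deriv (\<alpha> s) u - P (state_at s u v) * deriv (\<xi> s) v)
        has_real_derivative
          deriv (deriv (\<mu> s)) u + (Fu ?s * deriv (\<alpha> s) u + F0 s u v * deriv (deriv (\<alpha> s)) u)
          - P_u ?s * deriv (\<xi> s) v) (at u)"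
      by (auto intro!: derivative_eq_intros DERIV_u[OF sol uv] DERIV_P_u[OF sol uv])
  qed (rule compat_F0[OF sol _ uv(2)])
  then show ?thesis
    by (simp add: d2_mu_def deriv_alpha[OF sol uv] deriv2_alpha[OF uv])
qed

text \<open>\<open>\<xi>'\<close> and \<open>\<beta>'\<close> do not depend on \<open>u\<close>, so differentiating the compatibility condition of \<open>G0\<close> in \<open>u\<close> involves no
second derivative but \<open>\<mu>''\<close>, which is already known.\<close>
lemma obstr_zero:
  assumes uv: "u \<in> I" "v \<in> J"
  shows "obstr (state_at s u v) = 0"
proof -
  let ?s = "state_at s u v"
  have "Gu ?s * deriv (\<beta> s) v - (P_u ?s * deriv (\<mu> s) u + P ?s * deriv (deriv (\<mu> s)) u) = S4_u ?s"
  proof (rule DERIV_eq_on[OF uv(1) _ _ DERIV_S_u(3)[OF sol uv]])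
    show "((\<lambda>u. deriv (\<xi> s) v + G0 s u v * deriv (\<beta> s) v - P (state_at s u v) * deriv (\<mu> s) u)
        has_real_derivative
          Gu ?s * deriv (\<beta> s) v - (P_u ?s * deriv (\<mu> s) u + P ?s * deriv (deriv (\<mu> s)) u)) (at u)"
      by (auto intro!: derivative_eq_intros DERIV_u[OF sol uv] DERIV_P_u[OF sol uv])
  qed (rule compat_G0[OF sol _ uv(2)])
  then show ?thesis
    by (simp add: obstr_def deriv_beta[OF sol uv] deriv2_mu[OF uv])
qed

lemma DERIV_u_rate:
  assumes uv: "u \<in> I" "v \<in> J" and hk: "(h, k) \<in> u_rate"
  shows "((\<lambda>u. h (state_at s u v)) has_real_derivative k (state_at s u v)) (at u)"
  using hk DERIV_u[OF sol uv]
  by (auto simp: u_rate_def deriv_alpha[OF sol uv] deriv_kappa[OF sol uv] deriv2_mu[OF uv])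

end

section \<open>Germs and jets of solutions\<close>

lemma admissible_state_at:
  assumes "sol_on I J s" "u \<in> I" "v \<in> J"
  shows "state_at s u v \<in> admissible"
  using valid_state[OF assms] obstr_zero[OF assms] obstr_zero[OF sol_on_flip[OF assms(1)] assms(3,2)]
  by (simp add: admissible_def state_at_flip)

lemma state_at_unique_u:
  assumes s: "sol_on I J s" and t: "sol_on I J t" and I: "{a..b} \<subseteq> I" and v: "v \<in> J"
    and c: "c \<in> {a..b}" "state_at s c v = state_at t c v" and u: "u \<in> {a..b}"
  shows "state_at s u v = state_at t u v"
proof (rule u_rate_unique[where \<sigma> = "\<lambda>u. state_at s u v" and \<tau> = "\<lambda>u. state_at t u v", OF c _ _ u])
  show "valid (state_at s x v) \<and> valid (state_at t x v)" if "x \<in> {a..b}" for x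
    using valid_state[OF s _ v] valid_state[OF t _ v] I that by blast
  show "((\<lambda>x. h (state_at s x v)) has_real_derivative k (state_at s x v)) (at x) \<and>
      ((\<lambda>x. h (state_at t x v)) has_real_derivative k (state_at t x v)) (at x)"
    if "(h, k) \<in> u_rate" "x \<in> {a..b}" for h k x
    using DERIV_u_rate[OF s _ v] DERIV_u_rate[OF t _ v] I that by blast
qed

text \<open>Two solutions with the same state at the centre agree along the horizontal line through it, and from there
along every vertical line, which by flipping is again a line of constant second variable.\<close>
lemma state_at_unique:
  assumes s: "sol_on (ball u0 e) (ball v0 e) s" and t: "sol_on (ball u0 e) (ball v0 e) t"
    and eq: "state_at s u0 v0 = state_at t u0 v0" and uv: "u \<in> ball u0 e" "v \<in> ball v0 e"
  shows "state_at s u v = state_at t u v"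
proof -
  have e: "e > 0" using uv(1) zero_le_dist[of u0 u] unfolding mem_ball by linarith
  have seg: "{min x y..max x y} \<subseteq> ball x e" if "y \<in> ball x e" for x y :: real
    using that e by (auto simp: dist_real_def)
  have u0: "state_at s u v0 = state_at t u v0"
    by (rule state_at_unique_u[OF s t seg[OF uv(1)] _ _ eq]) (use e in auto)
  have "state_at (flip_unknowns s) v u = state_at (flip_unknowns t) v u"
    by (rule state_at_unique_u[OF sol_on_flip[OF s] sol_on_flip[OF t] seg[OF uv(2)] uv(1), of v0])
      (use u0 in \<open>auto simp: state_at_flip\<close>)
  then show ?thesis unfolding state_at_flip by (metis flip_simps(13))
qed

lemma Ck_on_subset: "Ck_on k S f \<Longrightarrow> T \<subseteq> S \<Longrightarrow> Ck_on k T f"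
proof (induction k arbitrary: f)
  case 0
  then show ?case using continuous_on_subset by simp
next
  case (Suc k)
  then show ?case by (simp add: subset_iff)
qed

lemma smooth_on_subset: "smooth_on S f \<Longrightarrow> T \<subseteq> S \<Longrightarrow> smooth_on T f"
  unfolding smooth_on_def using Ck_on_subset by blast

lemma sol_on_subset:
  assumes "sol_on I J s" "open I'" "open J'" "I' \<subseteq> I" "J' \<subseteq> J"
  shows "sol_on I' J' s"
proof -
  have "I' \<times> J' \<subseteq> I \<times> J" using assms by auto
  note sm = smooth_on_subset[OF _ this] smooth_on_subset[OF _ assms(4)] smooth_on_subset[OF _ assms(5)]
  have "\<forall>f\<in>{F0 s, F1 s, G0 s, G1 s}. smooth_on (I' \<times> J') (\<lambda>(u, v). f u v)"
    "\<forall>f\<in>{\<alpha> s, \<kappa> s, \<mu> s}. smooth_on I' f" "\<forall>f\<in>{\<beta> s, \<eta> s, \<xi> s}. smooth_on J' f"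
    using assms(1) sm unfolding sol_on_def by blast+
  with assms show ?thesis unfolding sol_on_def by (meson subsetD)
qed

lemma local_solution_sol_on:
  assumes "local_solution u0 v0 s" and F: "\<forall>\<^sub>F (u, v) in nhds (u0, v0). F0 s u v * G0 s u v \<noteq> 0"
  shows "\<exists>d>0. \<forall>e\<le>d. sol_on (ball u0 e) (ball v0 e) s"
proof -
  obtain I J where IJ: "open I" "open J" "u0 \<in> I" "v0 \<in> J"
    and sm: "\<forall>f\<in>{F0 s, F1 s, G0 s, G1 s}. smooth_on (I \<times> J) (\<lambda>(u, v). f u v)"
      "\<forall>f\<in>{\<alpha> s, \<kappa> s, \<mu> s}. smooth_on I f" "\<forall>f\<in>{\<beta> s, \<eta> s, \<xi> s}. smooth_on J f"
    and sys: "\<forall>u\<in>I. \<forall>v\<in>J. nondegenerate s u v \<and> satisfies_system s u v"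
    using assms(1) unfolding local_solution_def by blast
  obtain W where W: "open W" "(u0, v0) \<in> W" "\<And>x. x \<in> W \<Longrightarrow> case x of (u, v) \<Rightarrow> F0 s u v * G0 s u v \<noteq> 0"
    using F unfolding eventually_nhds by blast
  from open_prod_elim[OF W(1,2)] obtain I2 J2 where
    2: "open I2" "open J2" "(u0, v0) \<in> I2 \<times> J2" "I2 \<times> J2 \<subseteq> W" .
  have IJ2: "open (I \<inter> I2)" "open (J \<inter> J2)" "u0 \<in> I \<inter> I2" "v0 \<in> J \<inter> J2"
    using IJ 2 by auto
  have sub: "(I \<inter> I2) \<times> (J \<inter> J2) \<subseteq> I \<times> J" by auto
  have nz: "F0 s u v \<noteq> 0 \<and> G0 s u v \<noteq> 0" if "u \<in> I \<inter> I2" "v \<in> J \<inter> J2" for u v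
  proof -
    have "(u, v) \<in> W" using that 2(4) by auto
    from W(3)[OF this] show ?thesis by simp
  qed
  have "sol_on (I \<inter> I2) (J \<inter> J2) s"
    unfolding sol_on_def
  proof (intro conjI)
    show "\<forall>f\<in>{F0 s, F1 s, G0 s, G1 s}. smooth_on ((I \<inter> I2) \<times> (J \<inter> J2)) (\<lambda>(u, v). f u v)"
      using sm(1) smooth_on_subset[OF _ sub] by blast
    show "\<forall>f\<in>{\<alpha> s, \<kappa> s, \<mu> s}. smooth_on (I \<inter> I2) f"
      using sm(2) smooth_on_subset[OF _ Int_lower1] by blast
    show "\<forall>f\<in>{\<beta> s, \<eta> s, \<xi> s}. smooth_on (J \<inter> J2) f"
      using sm(3) smooth_on_subset[OF _ Int_lower1] by blast
    show "\<forall>u\<in>I \<inter> I2. \<forall>v\<in>J \<inter> J2. nondegenerate s u v \<and> satisfies_system s u v \<and> F0 s u v \<noteq> 0 \<and> G0 s u v \<noteq> 0"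
      using sys nz by simp
  qed (use IJ2 in auto)
  note sol = this
  obtain d1 where d1: "d1 > 0" "ball u0 d1 \<subseteq> I \<inter> I2" using openE[OF IJ2(1,3)] by blast
  obtain d2 where d2: "d2 > 0" "ball v0 d2 \<subseteq> J \<inter> J2" using openE[OF IJ2(2,4)] by blast
  show ?thesis
  proof (intro exI[of _ "min d1 d2"] conjI allI impI)
    show "min d1 d2 > 0" using d1 d2 by simp
    fix e assume e: "e \<le> min d1 d2"
    show "sol_on (ball u0 e) (ball v0 e) s"
    proof (rule sol_on_subset[OF sol open_ball open_ball])
      show "ball u0 e \<subseteq> I \<inter> I2" using e by (intro order_trans[OF subset_ball d1(2)]) simp
      show "ball v0 e \<subseteq> J \<inter> J2" using e by (intro order_trans[OF subset_ball d2(2)]) simp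
    qed
  qed
qed

text \<open>The values of the unknowns and the derivatives of \<open>\<mu>\<close> and \<open>\<xi>\<close> occur among the entries of the 1-jet.\<close>
lemma jet_of_inj:
  assumes "jet_of s = jet_of t"
  shows "s = t"
proof -
  have "(jet_row i j ! c) s = (jet_row i j ! c) t" if "c < 10" "i + j \<le> 1" for c i j
    using fun_cong[OF assms, of "(c, i, j)"] that by (simp add: jet_of_def)
  note eq = this[unfolded jet_row_def]
  show ?thesis
    using eq[of 0 0 0] eq[of 1 0 0] eq[of 2 0 0] eq[of 3 0 0] eq[of 4 0 0] eq[of 5 0 0] eq[of 6 0 0]
      eq[of 7 0 0] eq[of 8 0 0] eq[of 9 0 0] eq[of 6 1 0] eq[of 9 0 1]
    by (intro state.equality) simp_all
qed

lemma jet_conv_jet_of: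
  assumes sol: "sol_on I J s" and uv: "u \<in> I" "v \<in> J"
  shows "jet 1 u v s = jet_of (state_at s u v)"
proof -
  let ?s = "state_at s u v"
  have len: "length (components s) = 10" by (simp add: components_def)
  have 0: "map (\<lambda>f. f u v) (components s) = map (\<lambda>h. h ?s) (jet_row 0 0)"
    by (simp add: components_def jet_row_def)
  have u: "map (\<lambda>f. pdu f u v) (components s) = map (\<lambda>h. h ?s) (jet_row 1 0)"
    using partials_F[OF sol uv] partials_G[OF sol uv] deriv_alpha[OF sol uv] deriv_kappa[OF sol uv]
    by (simp add: components_def jet_row_def) (simp add: pdu_def)
  have v: "map (\<lambda>f. pdv f u v) (components s) = map (\<lambda>h. h ?s) (jet_row 0 1)"
    using partials_F[OF sol uv] partials_G[OF sol uv] deriv_beta[OF sol uv] deriv_eta[OF sol uv]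
    by (simp add: components_def jet_row_def) (simp add: pdv_def)
  have nth: "g (components s ! c) = (jet_row i j ! c) ?s"
    if "map g (components s) = map (\<lambda>h. h ?s) (jet_row i j)" "c < 10" for g i j c
    using arg_cong[OF that(1), of "\<lambda>xs. xs ! c"] that(2) by (simp add: len length_jet_row)
  show ?thesis
  proof (rule ext)
    fix k :: "nat \<times> nat \<times> nat"
    obtain c i j where k: "k = (c, i, j)" by (cases k)
    show "jet 1 u v s k = jet_of ?s k"
    proof (cases "c < 10 \<and> i + j \<le> 1")
      case True
      then consider "i = 0" "j = 0" | "i = 1" "j = 0" | "i = 0" "j = 1" by linarith
      then show ?thesis
        using True nth[OF 0, of c] nth[OF u, of c] nth[OF v, of c]
        by cases (simp_all add: jet_def jet_of_def k len)
    next
      case False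
      then show ?thesis unfolding jet_def jet_of_def k len prod.case by (simp only: if_False)
    qed
  qed
qed

theorem theorem4p1:
  fixes u0 v0 :: real
  shows "solution_space_dim_at_most TYPE(10) u0 v0
           {s. local_solution u0 v0 s \<and>
               (\<forall>\<^sub>F (u, v) in nhds (u0, v0). F0 s u v * G0 s u v \<noteq> 0)}"
    (is "solution_space_dim_at_most _ _ _ ?X")
proof -
  have X: "local_solution u0 v0 s" "\<forall>\<^sub>F (u, v) in nhds (u0, v0). F0 s u v * G0 s u v \<noteq> 0"
    if "s \<in> ?X" for s using that by blast+
  have jet: "jet 1 u0 v0 s = jet_of (state_at s u0 v0)" "state_at s u0 v0 \<in> admissible" if s: "s \<in> ?X" for s
  proof -
    from local_solution_sol_on[OF X[OF s]] obtain d
      where d: "d > 0" "\<forall>e\<le>d. sol_on (ball u0 e) (ball v0 e) s" by blast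
    then have "u0 \<in> ball u0 d" "v0 \<in> ball v0 d" by auto
    moreover have "sol_on (ball u0 d) (ball v0 d) s" using d(2) by simp
    ultimately show "jet 1 u0 v0 s = jet_of (state_at s u0 v0)" "state_at s u0 v0 \<in> admissible"
      using jet_conv_jet_of admissible_state_at by blast+
  qed
  have "same_germ u0 v0 s t" if s: "s \<in> ?X" and t: "t \<in> ?X" and eq: "jet 1 u0 v0 s = jet 1 u0 v0 t" for s t
  proof -
    have st: "state_at s u0 v0 = state_at t u0 v0"
      by (rule jet_of_inj) (use eq jet(1)[OF s] jet(1)[OF t] in argo)
    from local_solution_sol_on[OF X[OF s]] obtain d
      where d: "d > 0" "\<forall>e\<le>d. sol_on (ball u0 e) (ball v0 e) s" by blast
    from local_solution_sol_on[OF X[OF t]] obtain d'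
      where d': "d' > 0" "\<forall>e\<le>d'. sol_on (ball u0 e) (ball v0 e) t" by blast
    define e where "e = min d d'"
    have e: "e > 0" "sol_on (ball u0 e) (ball v0 e) s" "sol_on (ball u0 e) (ball v0 e) t"
      using d d' by (auto simp: e_def)
    note eq = state_at_unique[OF e(2,3) st]
    have all: "F0 s u v = F0 t u v \<and> F1 s u v = F1 t u v \<and> G0 s u v = G0 t u v \<and> G1 s u v = G1 t u v \<and>
        \<alpha> s u = \<alpha> t u \<and> \<kappa> s u = \<kappa> t u \<and> \<mu> s u = \<mu> t u \<and> \<beta> s v = \<beta> t v \<and> \<eta> s v = \<eta> t v \<and> \<xi> s v = \<xi> t v"
      if "u \<in> ball u0 e" "v \<in> ball v0 e" for u v
      using eq[OF that] by (simp add: state_at_def)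
    have c: "u0 \<in> ball u0 e" "v0 \<in> ball v0 e" using e by auto
    show ?thesis
      unfolding same_germ_def
      by (intro exI[of _ "ball u0 e"] exI[of _ "ball v0 e"] conjI ballI) (use c all all[OF _ c(2)] all[OF c(1)] in \<open>simp_all del: mem_ball\<close>)
  qed
  moreover have "jet 1 u0 v0 ` ?X \<subseteq> jet_of ` admissible"
    by (intro image_subsetI) (simp only: jet imageI)
  then have "dim_at_most TYPE(10) (jet 1 u0 v0 ` ?X)"
    by (rule dim_at_most_mono[OF dim_admissible])
  ultimately show ?thesis
    unfolding solution_space_dim_at_most_def by (intro exI[of _ 1]) blast
qed

end
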